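(* Let $j\in\{1,2,3\}$, so that $p_j\in\{2,3,5\}$. Then every natural number $N>5040$ with $p_j\nmid N$ satisfies Robin's inequality $\sigma(N)<e^\gamma N\log(\log N)$.
   Context: $p_1=2<p_2=3<p_3=5<\cdots$ denotes the increasing enumeration of the primes. $\sigma(N)=\sum_{d\mid N}d$ is the sum-of-divisors function and $\gamma$ is the Euler–Mascheroni constant. *)

theory Defs
  imports "HOL-Analysis.Analysis" "HOL-Computational_Algebra.Primes" "HOL-Library.Infinite_Set"
begin

definition sigma :: "nat \<Rightarrow> nat" where
  "sigma N = (\<Sum>d | d dvd N. d)"

text \<open>The j-th prime, 1-indexed: p 1 = 2, p 2 = 3, p 3 = 5, ...\<close>
definition pth :: "nat \<Rightarrow> nat" where
  "pth j = enumerate {p. prime p} (j - 1)"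

end

theory Submission
  imports Defs
begin

text \<open>
  Let \<open>p\<^sub>j = 5\<close> (the primes 2 and 3 give weaker requirements). With \<open>Q\<close> the set of primes
  dividing \<open>N\<close> and \<open>R\<close> the first \<open>card Q\<close> primes other than 5, exchanging elements gives
  \<open>\<sigma>(N)/N < \<Prod>\<^bsub>p\<in>Q\<^esub> p/(p - 1) \<le> \<Prod>\<^bsub>p\<in>R\<^esub> p/(p - 1)\<close> and
  \<open>N \<ge> \<Prod>Q \<ge> \<Prod>R\<close>. If \<open>R\<close> consists of the primes up to \<open>x\<close> other than 5, it remains to see that
  \<open>4/5 \<Prod>\<^bsub>p\<le>x\<^esub> p/(p - 1) < e\<^sup>\<gamma> ln (\<theta>(x) - ln 5)\<close>. As both sides are about
  \<open>e\<^sup>\<gamma> ln x\<close> up to the factor 4/5, crude estimates suffice: the constant in Mertens' product theorem is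
  not needed, since the product is computed at \<open>x = 4096\<close> and its growth beyond that point is bounded by
  partial summation from \<open>\<Sum>\<^bsub>p\<le>x\<^esub> ln p / p\<close>, which in turn is read off from \<open>ln n!\<close>, while
  \<open>\<theta>(x)\<close> is bounded by Chebyshev's binomial arguments. For \<open>19 \<le> x \<le> 4096\<close> the inequality is checked
  numerically. For \<open>x < 19\<close> the product over \<open>R\<close> is too crude only if \<open>N\<close> is small; then
  2 or 3 occurs in \<open>N\<close> to a low power, which saves a constant factor.
\<close>

section \<open>Chebyshev's function and Mertens' sum and product\<close>

definition primes_le :: "nat \<Rightarrow> nat set" where
  "primes_le n = {p. prime p \<and> p \<le> n}"

definition theta :: "nat \<Rightarrow> real" where
  "theta n = (\<Sum>p\<in>primes_le n. ln (real p))"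

definition mertens_sum :: "nat \<Rightarrow> real" where
  "mertens_sum n = (\<Sum>p\<in>primes_le n. ln (real p) / real p)"

definition euler_prod :: "nat \<Rightarrow> real" where
  "euler_prod n = (\<Prod>p\<in>primes_le n. real p / (real p - 1))"

lemma finite_primes_le [simp, intro]: "finite (primes_le n)"
  unfolding primes_le_def by (rule finite_subset[of _ "{..n}"]) auto

lemma primes_le_0 [simp]: "primes_le 0 = {}"
  by (auto simp: primes_le_def)

lemma primes_le_mono: "m \<le> n \<Longrightarrow> primes_le m \<subseteq> primes_le n"
  by (auto simp: primes_le_def)

lemma primes_le_Suc:
  "primes_le (Suc n) = (if prime (Suc n) then insert (Suc n) (primes_le n) else primes_le n)"
  by (auto simp: primes_le_def le_Suc_eq)

lemma Suc_notin_primes_le [simp]: "Suc n \<notin> primes_le n"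
  by (auto simp: primes_le_def)

lemma primes_le_ge_2: "p \<in> primes_le n \<Longrightarrow> 2 \<le> p"
  by (auto simp: primes_le_def prime_ge_2_nat)

lemma theta_mono: "m \<le> n \<Longrightarrow> theta m \<le> theta n"
  unfolding theta_def
  by (intro sum_mono2 primes_le_mono) (auto dest!: primes_le_ge_2 intro!: ln_ge_zero)

lemma euler_prod_pos: "0 < euler_prod n"
  unfolding euler_prod_def by (intro prod_pos) (auto dest!: primes_le_ge_2)

lemma euler_prod_mono: "m \<le> n \<Longrightarrow> euler_prod m \<le> euler_prod n"
  unfolding euler_prod_def
  by (intro prod_mono2 primes_le_mono) (auto dest!: primes_le_ge_2 simp: divide_simps)

section \<open>Numerical values up to 4096\<close>

text \<open>
  Fixed-point arithmetic with unit \<open>1/1000000\<close>: \<open>q\<close> is the last prime met, \<open>l\<close> a lower bound of its logarithm,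
  and \<open>P\<close>, \<open>T\<close>, \<open>M\<close> bound the product from above and the two sums from below.
\<close>

definition numeric_bounds ::
  "nat \<Rightarrow> nat \<Rightarrow> nat \<Rightarrow> nat \<Rightarrow> nat \<Rightarrow> nat \<Rightarrow> bool" where
  "numeric_bounds a q l P T M \<longleftrightarrow> 2 \<le> q \<and> q \<le> a \<and> real l \<le> 1000000 * ln (real q)
     \<and> 1000000 * euler_prod a \<le> real P \<and> real T \<le> 1000000 * theta a
     \<and> real M \<le> 1000000 * mertens_sum a"

section \<open>Trial division and the fixed-point sweep\<close>

primrec trial_division :: "nat \<Rightarrow> nat list \<Rightarrow> bool" where
  "trial_division n [] = True"
| "trial_division n (d # ds) =
     (if n < d * d then True else if n mod d = 0 then False else trial_division n ds)"

definition odd_primes_le_61 :: "nat list" where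
  "odd_primes_le_61 = [3, 5, 7, 11, 13, 17, 19, 23, 29, 31, 37, 41, 43, 47, 53, 59, 61]"

text \<open>
  A separate function, so that the simplifier evaluates the new logarithm once before it is used
  three times. The new logarithm comes from \<open>ln n - ln q \<ge> 2 (n - q) / (n + q)\<close>.
\<close>

definition sweep_prime where
  "sweep_prime F n l P T M = F n n (l::nat) (P + P div (n - 1) + 1) (T + l) (M + l div n)"

text \<open>Started at an odd \<open>a\<close>, the sweep visits odd numbers only, so
  \<open>k\<close> steps end at \<open>a + 2 * k\<close>.\<close>

primrec sweep :: "nat \<Rightarrow> nat \<Rightarrow> nat \<Rightarrow> nat \<Rightarrow> nat \<Rightarrow> nat \<Rightarrow> nat
    \<Rightarrow> nat \<times> nat \<times> nat \<times> nat \<times> nat \<times> nat" where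
  "sweep 0 a q l P T M = (a, q, l, P, T, M)"
| "sweep (Suc k) a q l P T M =
    (if trial_division (a + 2) odd_primes_le_61
     then sweep_prime (sweep k) (a + 2) (l + (2000000 * (a + 2 - q)) div (a + 2 + q)) P T M
     else sweep k (a + 2) q l P T M)"

text \<open>Lets the simplifier run the recursion directly on a numeral step count.\<close>

lemmas sweep_numeral = sweep.simps(2)[of "pred_numeral k" for k, folded numeral_eq_Suc]

text \<open>The smaller cofactor \<open>d\<close> of a proper factorisation has
  \<open>d * d <= n\<close>, and so does any prime factor of it.\<close>

lemma prime_divisor_le_sqrt:
  fixes n :: nat
  assumes "1 < n" "\<not> prime n"
  obtains p where "prime p" "p dvd n" "p * p \<le> n"
proof -
  obtain d where d: "d dvd n" "d \<noteq> 1" "d \<noteq> n"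
    using assms by (auto simp: prime_nat_iff)
  then obtain e where e: "n = d * e" by (elim dvdE)
  have *: thesis if "d \<le> e" "n = d * e" "d \<noteq> 1" for d e
  proof -
    obtain p where p: "prime p" "p dvd d" using prime_factor_nat[OF \<open>d \<noteq> 1\<close>] by blast
    have "0 < d" using that(2) assms(1) by (cases d) auto
    then have "p \<le> d" using p(2) by (simp add: dvd_imp_le)
    then have "p * p \<le> n" using that by (metis le_trans mult_le_mono)
    then show ?thesis
      using that(2) p \<open>\<And>p. prime p \<Longrightarrow> p dvd n \<Longrightarrow> p * p \<le> n \<Longrightarrow> thesis\<close>
      by (metis dvd_mult2)
  qed
  have "e \<noteq> 1" using d e by auto
  show thesis
    using *[of d e] *[of e d] d(2) \<open>e \<noteq> 1\<close> e by (cases "d \<le> e") (auto simp: mult.commute)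
qed

text \<open>Sortedness makes the early exit at \<open>n < e * e\<close> safe: it skips only numbers
  beyond the square root.\<close>

lemma trial_division_not_dvd:
  assumes "sorted ds" "trial_division n ds" "d \<in> set ds" "d * d \<le> n"
  shows "\<not> d dvd n"
  using assms
proof (induction ds)
  case (Cons e ds)
  show ?case
  proof (cases "n < e * e")
    case True
    have "e \<le> d" using Cons.prems by auto
    then have "e * e \<le> d * d" by (rule mult_le_mono) fact
    then show ?thesis using True Cons.prems by simp
  next
    case False
    then show ?thesis using Cons by (auto split: if_splits simp: dvd_eq_mod_eq_0)
  qed
qed simp

lemma trial_division_dvd:
  assumes "\<not> trial_division n ds"
  shows "\<exists>d\<in>set ds. d * d \<le> n \<and> d dvd n"
  using assms by (induction ds) (auto split: if_splits simp: dvd_eq_mod_eq_0)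

text \<open>The list holds all odd primes below 67, so an odd composite number below 67^2 has a
  divisor in it.\<close>

lemma trial_division_iff_prime:
  assumes "odd n" "1 < n" "n < 67 * 67"
  shows "trial_division n odd_primes_le_61 \<longleftrightarrow> prime n"
    (is "trial_division n ?ds \<longleftrightarrow> _")
proof
  assume td: "trial_division n ?ds"
  show "prime n"
  proof (rule ccontr)
    assume "\<not> prime n"
    then obtain p where p: "prime p" "p dvd n" "p * p \<le> n"
      using prime_divisor_le_sqrt[OF \<open>1 < n\<close>] by blast
    have "p < 67"
    proof (rule ccontr)
      assume "\<not> p < 67"
      then have "67 * 67 \<le> p * p" by (intro mult_le_mono) auto
      then show False using p(3) assms(3) by simp
    qed
    then have "p \<in> set [2..<67]"
      using prime_ge_2_nat[OF p(1)] by (simp only: set_upt atLeastLessThan_iff)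
    moreover have "list_all (\<lambda>p. prime p \<longrightarrow> p = 2 \<or> p \<in> set ?ds) [2..<67]"
      by (simp add: upt_rec_numeral odd_primes_le_61_def)
    moreover have "p \<noteq> 2" using p(2) assms(1) by auto
    ultimately have "p \<in> set ?ds" using p(1) unfolding list_all_iff by blast
    moreover have "sorted ?ds" by (simp add: odd_primes_le_61_def)
    ultimately show False using trial_division_not_dvd[OF _ td _ p(3)] p(2) by blast
  qed
next
  assume "prime n"
  show "trial_division n ?ds"
  proof (rule ccontr)
    assume "\<not> trial_division n ?ds"
    then obtain d where d: "d \<in> set ?ds" "d * d \<le> n" "d dvd n"
      using trial_division_dvd by blast
    have "\<forall>d\<in>set ?ds. 1 < d" by (simp add: odd_primes_le_61_def)
    then have "1 < d" using d(1) by blast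
    then have "d = n" using d(3) \<open>prime n\<close> by (auto simp: prime_nat_iff)
    then have "n * n \<le> n * 1" using d(2) by simp
    then show False using \<open>1 < n\<close> by simp
  qed
qed

lemma numeric_bounds_skip:
  assumes "numeric_bounds a q l P T M" "\<not> prime (Suc a)"
  shows "numeric_bounds (Suc a) q l P T M"
  using assms
  by (auto simp: numeric_bounds_def theta_def mertens_sum_def euler_prod_def primes_le_Suc)

lemma not_prime_even_Suc: "odd a \<Longrightarrow> 2 \<le> a \<Longrightarrow> \<not> prime (Suc a)"
  using prime_odd_nat[of "Suc a"] by auto

lemma numeric_bounds_Suc: 
  assumes "numeric_bounds a q l P T M" "odd a"
  shows "numeric_bounds (Suc a) q l P T M"
  using assms by (intro numeric_bounds_skip not_prime_even_Suc) (auto simp: numeric_bounds_def)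

lemma numeric_bounds_prime:
  assumes b: "numeric_bounds a q l P T M" and pr: "prime (Suc a)"
    and l': "l' = l + (2000000 * (Suc a - q)) div (Suc a + q)"
  shows "numeric_bounds (Suc a) (Suc a) l' (P + P div a + 1) (T + l') (M + l' div Suc a)"
proof -
  define x where "x = real (Suc a)"
  have q: "2 \<le> q" "q \<le> a" and l: "real l \<le> 1000000 * ln (real q)"
    using b by (auto simp: numeric_bounds_def)
  have x: "x > real q" "x > 1" using q by (auto simp: x_def)
  have "2 * (x - real q) / (x + real q) \<le> ln x - ln (real q)"
    using ln_inverse_approx_ge[of "real q" x] x q by (simp add: add.commute)
  moreover have "real ((2000000 * (Suc a - q)) div (Suc a + q)) \<le> 1000000 * (2 * (x - real q) / (x + real q))"
    using of_nat_div_le_of_nat[of "2000000 * (Suc a - q)" "Suc a + q", where 'a = real] q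
    by (simp add: x_def of_nat_diff algebra_simps)
  ultimately have l'_le: "real l' \<le> 1000000 * ln x" using l unfolding l' of_nat_add by linarith
  \<comment> \<open>Passing the prime \<open>a + 1\<close> multiplies the product by 1 + 1/a. Adding
    \<open>P div a + 1\<close> rounds P/a up, so \<open>P\<close> remains an upper bound; the two
    sums are rounded down instead.\<close>
  have "real P / real a \<le> real (P div a) + 1"
  proof -
    have "P \<le> a * (P div a + 1)"
      using dividend_less_times_div[of a P] q by simp
    then have "real P \<le> real a * (real (P div a) + 1)"
      by (metis of_nat_1 of_nat_add of_nat_le_iff of_nat_mult)
    then show ?thesis using q by (simp add: field_simps)
  qed
  then have *: "real P * (x / (x - 1)) \<le> real (P + P div a + 1)"
    using q by (simp add: x_def field_simps)
  have "1000000 * euler_prod (Suc a) = 1000000 * euler_prod a * (x / (x - 1))"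
    using pr by (simp add: euler_prod_def primes_le_Suc x_def)
  also have "\<dots> \<le> real P * (x / (x - 1))"
    using b x by (intro mult_right_mono) (auto simp: numeric_bounds_def)
  also note *
  finally have P: "1000000 * euler_prod (Suc a) \<le> real (P + P div a + 1)" .
  have "real (l' div Suc a) \<le> real l' / x"
    unfolding x_def by (rule of_nat_div_le_of_nat)
  also have "\<dots> \<le> 1000000 * ln x / x"
    using l'_le x by (intro divide_right_mono) auto
  finally have M: "real (l' div Suc a) \<le> 1000000 * (ln x / x)" by simp
  show ?thesis
    using b pr q l'_le P M
    by (simp add: numeric_bounds_def theta_def mertens_sum_def primes_le_Suc x_def algebra_simps)
qed

text \<open>Each step crosses the even number \<open>a + 1\<close>, where nothing changes, and then
  tests \<open>a + 2\<close>. The limit 67 * 67 keeps trial division exact.\<close>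

lemma sweep_sound:
  assumes "sweep k a q l P T M = (a', q', l', P', T', M')"
    and "numeric_bounds a q l P T M" "odd a" "a + 2 * k < 67 * 67"
  shows "numeric_bounds a' q' l' P' T' M'"
  using assms
proof (induction k arbitrary: a q l P T M)
  case (Suc k)
  have a: "2 \<le> a" using Suc.prems(2) by (auto simp: numeric_bounds_def)
  have b: "numeric_bounds (Suc a) q l P T M"
    using Suc.prems by (intro numeric_bounds_skip not_prime_even_Suc a)
  have td: "trial_division (a + 2) odd_primes_le_61 \<longleftrightarrow> prime (a + 2)"
    using Suc.prems by (intro trial_division_iff_prime) auto
  show ?case
  proof (cases "prime (a + 2)")
    case True
    have "numeric_bounds (a + 2) (a + 2) (l + (2000000 * (a + 2 - q)) div (a + 2 + q))
        (P + P div (a + 2 - 1) + 1) (T + (l + (2000000 * (a + 2 - q)) div (a + 2 + q)))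
        (M + (l + (2000000 * (a + 2 - q)) div (a + 2 + q)) div (a + 2))"
      using numeric_bounds_prime[OF b _ refl] True by simp
    moreover have "sweep k (a + 2) (a + 2) (l + (2000000 * (a + 2 - q)) div (a + 2 + q))
        (P + P div (a + 2 - 1) + 1) (T + (l + (2000000 * (a + 2 - q)) div (a + 2 + q)))
        (M + (l + (2000000 * (a + 2 - q)) div (a + 2 + q)) div (a + 2)) = (a', q', l', P', T', M')"
      using Suc.prems True td by (simp add: sweep_prime_def)
    ultimately show ?thesis
      using Suc.prems(3,4) Suc.IH by simp
  next
    case False
    then have "numeric_bounds (a + 2) q l P T M"
      using numeric_bounds_skip[OF b] by simp
    moreover have "sweep k (a + 2) q l P T M = (a', q', l', P', T', M')"
      using Suc.prems False td by simp
    ultimately show ?thesis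
      using Suc.prems(3,4) Suc.IH by simp
  qed
qed simp

section \<open>Logarithms of small primes and the checkpoints of the sweep\<close>

lemma ln_bounds_small:
  "6931 / 10000 \<le> ln (2::real)" "ln (2::real) \<le> 6932 / 10000"
  "10986 / 10000 \<le> ln (3::real)"
  "16094 / 10000 \<le> ln (5::real)" "ln (5::real) \<le> 3219 / 2000" "19459 / 10000 \<le> ln (7::real)"
proof -
  show ln2: "6931 / 10000 \<le> ln (2::real)" "ln (2::real) \<le> 6932 / 10000"
    using ln_approx_bounds[of 2 5] by (simp_all add: eval_nat_numeral)
  show "10986 / 10000 \<le> ln (3::real)"
    using ln_approx_bounds[of 3 7] by (simp add: eval_nat_numeral)
  show "16094 / 10000 \<le> ln (5::real)" "ln (5::real) \<le> 3219 / 2000"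
    using ln_approx_bounds[of 5 14] by (simp_all add: eval_nat_numeral)
  show "19459 / 10000 \<le> ln (7::real)"
    using ln_approx_bounds[of 7 18] by (simp add: eval_nat_numeral)
qed

lemma primes_le_eq_filter: "primes_le n = set (filter prime [2..<Suc n])"
  by (auto simp: primes_le_def prime_ge_2_nat intro: order_trans[OF prime_ge_2_nat])

lemma primes_le_7: "primes_le 7 = {2, 3, 5, 7}"
  by (simp add: primes_le_eq_filter upt_rec_numeral)

lemma numeric_bounds_7: "numeric_bounds 7 7 1945900 4375000 5347000 1312600"
  using ln_bounds_small
  by (simp add: numeric_bounds_def euler_prod_def theta_def mertens_sum_def primes_le_7)

lemma numeric_bounds_sweep:
  assumes "numeric_bounds a q l P T M" "odd a" "a + 2 * k < 67 * 67"
    and "sweep k a q l P T M = (a', q', l', P', T', M')"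
  shows "numeric_bounds a' q' l' P' T' M'"
  using assms(4,1,2,3) by (rule sweep_sound)

lemmas sweep_eval = sweep_numeral sweep_prime_def odd_primes_le_61_def

text \<open>From here on the checkpoints are the block ends in
  \<open>euler_prod_lt_finite_range\<close>; those at 1117, 1617, 2117 and 3401 only divide long
  evaluations into shorter ones.\<close>

lemma numeric_bounds_19: "numeric_bounds 19 19 2934787 5847134 16052817 2047157"
  by (rule numeric_bounds_sweep[OF numeric_bounds_7, of 6]) (simp_all add: sweep_eval)

lemma numeric_bounds_21: "numeric_bounds 21 19 2934787 5847134 16052817 2047157"
  by (rule numeric_bounds_sweep[OF numeric_bounds_19, of 1]) (simp_all add: sweep_eval)

lemma numeric_bounds_23: "numeric_bounds 23 23 3125263 6112913 19178080 2183038"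
  by (rule numeric_bounds_sweep[OF numeric_bounds_21, of 1]) (simp_all add: sweep_eval)

lemma numeric_bounds_29: "numeric_bounds 29 29 3356032 6331232 22534112 2298763"
  by (rule numeric_bounds_sweep[OF numeric_bounds_23, of 3]) (simp_all add: sweep_eval)

lemma numeric_bounds_31: "numeric_bounds 31 31 3422698 6542274 25956810 2409172"
  by (rule numeric_bounds_sweep[OF numeric_bounds_29, of 1]) (simp_all add: sweep_eval)

lemma numeric_bounds_45: "numeric_bounds 45 43 3749351 7056203 37007061 2683926"
  by (rule numeric_bounds_sweep[OF numeric_bounds_31, of 7]) (simp_all add: sweep_eval)

lemma numeric_bounds_47: "numeric_bounds 47 47 3838239 7209599 40845300 2765590"
  by (rule numeric_bounds_sweep[OF numeric_bounds_45, of 1]) (simp_all add: sweep_eval)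

lemma numeric_bounds_87: "numeric_bounds 87 83 4406541 8133262 74452445 3265656"
  by (rule numeric_bounds_sweep[OF numeric_bounds_47, of 20]) (simp_all add: sweep_eval)

lemma numeric_bounds_89: "numeric_bounds 89 89 4476308 8225686 78928753 3315951"
  by (rule numeric_bounds_sweep[OF numeric_bounds_87, of 1]) (simp_all add: sweep_eval)

lemma numeric_bounds_205: "numeric_bounds 205 199 5280697 9625162 188062992 4083740"
  by (rule numeric_bounds_sweep[OF numeric_bounds_89, of 58]) (simp_all add: sweep_eval)

lemma numeric_bounds_617: "numeric_bounds 617 617 6412149 11521586 587280906 5135874"
  by (rule numeric_bounds_sweep[OF numeric_bounds_205, of 206]) (simp_all add: sweep_eval)

lemma numeric_bounds_1117: "numeric_bounds 1117 1117 7005638 12574635 1086310691 5722600"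
  by (rule numeric_bounds_sweep[OF numeric_bounds_617, of 250]) (simp_all add: sweep_eval)

lemma numeric_bounds_1617: "numeric_bounds 1617 1613 7373056 13217295 1576702091 6081309"
  by (rule numeric_bounds_sweep[OF numeric_bounds_1117, of 250]) (simp_all add: sweep_eval)

lemma numeric_bounds_2117: "numeric_bounds 2117 2113 7643040 13679784 2057948762 6339590"
  by (rule numeric_bounds_sweep[OF numeric_bounds_1617, of 250]) (simp_all add: sweep_eval)

lemma numeric_bounds_2701: "numeric_bounds 2701 2699 7887771 14107679 2633246555 6578771"
  by (rule numeric_bounds_sweep[OF numeric_bounds_2117, of 292]) (simp_all add: sweep_eval)

lemma numeric_bounds_3401: "numeric_bounds 3401 3391 8115969 14508859 3313804565 6803035"
  by (rule numeric_bounds_sweep[OF numeric_bounds_2701, of 350]) (simp_all add: sweep_eval)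

lemma numeric_bounds_4095: "numeric_bounds 4095 4093 8304081 14846661 4020266180 6991942"
  by (rule numeric_bounds_sweep[OF numeric_bounds_3401, of 347]) (simp_all add: sweep_eval)

section \<open>Chebyshev and Mertens bounds\<close>

lemma prod_primes_dvd:
  fixes A :: "nat set"
  assumes "finite A" "\<And>p. p \<in> A \<Longrightarrow> prime p \<and> p dvd n"
  shows "\<Prod>A dvd n"
  using assms
proof (induction A)
  case (insert p A)
  have "coprime p (\<Prod>A)"
    using insert by (intro prod_coprime_right) (metis insertCI primes_coprime)
  then show ?case using insert by (simp add: divides_mult)
qed simp

lemma ln_prod_primes:
  assumes "finite A" "\<And>p. p \<in> A \<Longrightarrow> prime (p :: nat)"
  shows "ln (real (\<Prod>A)) = (\<Sum>p\<in>A. ln (real p))"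
  using assms by (simp add: ln_prod prime_gt_0_nat)

text \<open>The coefficient occurs twice, at \<open>m\<close> and at \<open>m + 1\<close>, in a row
  with sum \<open>2 ^ (2 * m + 1)\<close>.\<close>

lemma binomial_odd_le_4_power: "(2 * m + 1) choose m \<le> 4 ^ m"
proof -
  have "2 * ((2 * m + 1) choose m) = (\<Sum>k\<in>{m, m + 1}. (2 * m + 1) choose k)"
    using binomial_symmetric[of m "2 * m + 1"] by simp
  also have "\<dots> \<le> (\<Sum>k\<le>2 * m + 1. (2 * m + 1) choose k)"
    by (intro sum_mono2) auto
  also have "\<dots> = 2 ^ (2 * m + 1)" by (rule choose_row_sum)
  finally show ?thesis by (simp add: power_mult)
qed

text \<open>Erdos' induction: for n = 2m + 1 every prime p with m + 1 < p <= n divides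
  \<open>n choose m\<close>, which is at most 4^m. An even n > 2 adds no prime.\<close>

lemma theta_le: "theta n \<le> real n * ln 4"
proof (induction n rule: less_induct)
  case (less n)
  consider "n = 0" | "n = 1" | "n = 2" | "n > 2" "even n" | m where "n = 2 * m + 1" "m \<ge> 1"
    by (metis One_nat_def add_cancel_right_left bot_nat_0.not_eq_extremum less_2_cases linorder_neqE_nat
        mult_0_right not_less_eq_eq oddE Suc_leI)
  then show ?case
  proof cases
    case 1
    then show ?thesis by (simp add: theta_def)
  next
    case 2
    then have "primes_le n = {}" by (auto simp: primes_le_def dest: prime_ge_2_nat)
    then show ?thesis using 2 by (simp add: theta_def)
  next
    case 3
    then have "primes_le n = {2}" by (auto simp: primes_le_def dest: prime_ge_2_nat)
    then show ?thesis using 3 ln_realpow[of 2 2] by (simp add: theta_def)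
  next
    case 4
    then obtain k where k: "n = Suc k" by (cases n) auto
    have "\<not> prime n" using 4 prime_odd_nat by auto
    then have "theta n = theta k" using k by (simp add: theta_def primes_le_Suc)
    also have "\<dots> \<le> real k * ln 4" using less k by simp
    also have "\<dots> \<le> real n * ln 4" using k by (intro mult_right_mono) auto
    finally show ?thesis .
  next
    case (5 m)
    define A where "A = primes_le n - primes_le (m + 1)"
    have A: "prime p \<and> p dvd (n choose m)" if "p \<in> A" for p
    proof -
      have p: "prime p" "p \<le> n" "m + 1 < p" using that by (auto simp: A_def primes_le_def)
      have "p dvd fact n" using p by (simp add: prime_dvd_fact_iff)
      moreover have "fact n = fact m * fact (m + 1) * (n choose m)"
        using binomial_fact_lemma[of m n] 5 by simp
      moreover have "\<not> p dvd fact m" "\<not> p dvd fact (m + 1)"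
        using p by (simp_all only: prime_dvd_fact_iff)
      ultimately show ?thesis using p(1) by (simp add: prime_dvd_mult_iff del: fact_Suc)
    qed
    have fin: "finite A" by (simp add: A_def)
    have "\<Prod>A dvd (n choose m)" using fin A by (rule prod_primes_dvd)
    then have "\<Prod>A \<le> n choose m" using 5 by (intro dvd_imp_le) auto
    also have "\<dots> \<le> 4 ^ m" using binomial_odd_le_4_power 5 by simp
    finally have "real (\<Prod>A) \<le> real (4 ^ m)" by (simp only: of_nat_le_iff)
    moreover have "0 < \<Prod>A" using fin A by (intro prod_pos) (auto simp: prime_gt_0_nat)
    then have "0 < real (\<Prod>A)" by (simp only: of_nat_0_less_iff)
    ultimately have "ln (real (\<Prod>A)) \<le> ln (real (4 ^ m))"
      by (intro ln_mono)
    then have "(\<Sum>p\<in>A. ln (real p)) \<le> real m * ln 4"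
      using fin A by (simp add: ln_prod_primes ln_realpow del: of_nat_prod)
    moreover have "theta n = theta (m + 1) + (\<Sum>p\<in>A. ln (real p))"
      unfolding theta_def A_def using 5
      by (subst sum.subset_diff[of "primes_le (m + 1)" "primes_le n"]) (auto simp: primes_le_def)
    moreover have "theta (m + 1) \<le> real (m + 1) * ln 4" using 5 by (intro less.IH) simp
    ultimately show ?thesis using 5 by (simp add: algebra_simps)
  qed
qed

section \<open>Legendre's formula for factorials\<close>

lemma card_multiples: "0 < d \<Longrightarrow> card {m \<in> {1..n}. d dvd m} = n div d"
proof -
  assume d: "0 < (d :: nat)"
  have "{m \<in> {1..n}. d dvd m} = (\<lambda>k. d * k) ` {1..n div d}"
    using d by (auto simp: dvd_def image_iff less_eq_div_iff_mult_less_eq mult.commute Suc_le_eq)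
  moreover have "inj_on (\<lambda>k. d * k) {1..n div d}" using d by (auto simp: inj_on_def)
  ultimately show ?thesis by (simp add: card_image)
qed

lemma multiplicity_fact_eq_sum:
  fixes p :: nat
  assumes "prime p"
  shows "multiplicity p (fact n :: nat) = (\<Sum>m=1..n. multiplicity p m)"
proof (induction n)
  case (Suc n)
  have "multiplicity p (fact (Suc n) :: nat) = multiplicity p (Suc n * fact n)"
    by (simp only: fact_Suc of_nat_id)
  also have "\<dots> = multiplicity p (Suc n) + multiplicity p (fact n :: nat)"
    using assms by (intro prime_elem_multiplicity_mult_distrib) auto
  finally show ?case using Suc by simp
qed simp

lemma card_power_dvd:
  fixes p m :: nat
  assumes "prime p" "0 < m"
  shows "card {i \<in> {1..k}. p ^ i dvd m} = min k (multiplicity p m)"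
proof -
  have *: "p ^ i dvd m \<longleftrightarrow> i \<le> multiplicity p m" for i
    using assms prime_gt_1_nat[of p] by (intro power_dvd_iff_le_multiplicity) auto
  have "{i \<in> {1..k}. p ^ i dvd m} = {1..min k (multiplicity p m)}"
    by (simp only: set_eq_iff mem_Collect_eq atLeastAtMost_iff min.bounded_iff conj_assoc * simp_thms)
  then show ?thesis by simp
qed

text \<open>Double counting of the pairs (i, m) with \<open>p ^ i dvd m\<close>; the minimum
  reflects the cut-off of the exponents at \<open>k\<close>.\<close>

lemma sum_div_prime_powers:
  fixes p :: nat
  assumes "prime p"
  shows "(\<Sum>i=1..k. n div p ^ i) = (\<Sum>m=1..n. min k (multiplicity p m))"
proof -
  have "(\<Sum>i=1..k. n div p ^ i) = (\<Sum>i=1..k. \<Sum>m=1..n. if p ^ i dvd m then 1 else 0)"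
    using assms by (intro sum.cong) (simp_all add: card_multiples[symmetric] prime_gt_0_nat sum.If_cases Int_def)
  also have "\<dots> = (\<Sum>m=1..n. \<Sum>i=1..k. if p ^ i dvd m then 1 else 0)"
    by (rule sum.swap)
  also have "\<dots> = (\<Sum>m=1..n. min k (multiplicity p m))"
    using assms by (intro sum.cong) (simp_all add: card_power_dvd[symmetric] sum.If_cases Int_def)
  finally show ?thesis .
qed

lemma multiplicity_fact_ge:
  fixes p :: nat
  assumes "prime p"
  shows "(\<Sum>i=1..k. n div p ^ i) \<le> multiplicity p (fact n :: nat)"
  unfolding sum_div_prime_powers[OF assms] multiplicity_fact_eq_sum[OF assms] by (intro sum_mono) simp

lemma multiplicity_fact:
  fixes p :: nat
  assumes "prime p" "n < p ^ Suc k"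
  shows "multiplicity p (fact n :: nat) = (\<Sum>i=1..k. n div p ^ i)"
proof -
  have "min k (multiplicity p m) = multiplicity p m" if "m \<in> {1..n}" for m
  proof -
    have "\<not> p ^ Suc k dvd m" using that assms(2) by (auto dest!: dvd_imp_le)
    then have "multiplicity p m < Suc k"
      using that assms(1) by (subst (asm) power_dvd_iff_le_multiplicity) auto
    then show ?thesis by simp
  qed
  then show ?thesis
    unfolding sum_div_prime_powers[OF assms(1)] multiplicity_fact_eq_sum[OF assms(1)] by simp
qed

section \<open>The logarithm of n! and Mertens' sum\<close>

lemma ln_eq_sum_multiplicity:
  assumes "0 < m" "finite A" "prime_factors m \<subseteq> A" "\<And>p. p \<in> A \<Longrightarrow> prime p"
  shows "ln (real m) = (\<Sum>p\<in>A. real (multiplicity p m) * ln (real p))"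
proof -
  have "m = (\<Prod>p\<in>prime_factors m. p ^ multiplicity p m)"
    using assms(1) by (intro prime_factorization_nat) auto
  also have "\<dots> = (\<Prod>p\<in>A. p ^ multiplicity p m)"
    using assms by (intro prod.mono_neutral_left) (auto simp: prime_factors_multiplicity)
  finally have "ln (real m) = ln (\<Prod>p\<in>A. real p ^ multiplicity p m)"
    by (metis (no_types, lifting) of_nat_power of_nat_prod prod.cong)
  also have "\<dots> = (\<Sum>p\<in>A. ln (real p ^ multiplicity p m))"
    using assms by (intro ln_prod) (auto simp: prime_gt_0_nat)
  also have "\<dots> = (\<Sum>p\<in>A. real (multiplicity p m) * ln (real p))"
    using assms by (intro sum.cong) (auto simp: ln_realpow prime_gt_0_nat)
  finally show ?thesis .
qed

lemma prime_factors_fact_eq: "prime_factors (fact n) = primes_le n"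
  by (auto simp: prime_factors_fact primes_le_def prime_ge_2_nat)

text \<open>A one-sided Stirling estimate: the induction step amounts to (n + 1)(ln (n + 1) - ln n)
  >= 1.\<close>

lemma ln_fact_le:
  assumes "1 \<le> n"
  shows "ln (fact n) \<le> real n * ln (real n) - real n + 1 + ln (real n)"
  using assms
proof (induction n rule: dec_induct)
  case (step n)
  have n: "0 < n" using step by simp
  have "ln (fact (Suc n)) = ln (real (Suc n)) + ln (fact n)"
    by (simp add: ln_mult)
  moreover have "1 / real (Suc n) \<le> ln (real (Suc n)) - ln (real n)"
  proof -
    have "ln (real n / real (Suc n)) \<le> real n / real (Suc n) - 1"
      using n by (intro ln_le_minus_one) auto
    then show ?thesis using n by (simp add: ln_div field_simps)
  qed
  then have "1 \<le> real (Suc n) * (ln (real (Suc n)) - ln (real n))"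
    by (simp add: field_simps)
  ultimately show ?case using step.IH by (simp add: algebra_simps)
qed simp


text \<open>Legendre's formula bounds ln n! from below by n times the Mertens sum, minus theta(n),
  plus the higher powers of 2, 3, 5; Stirling bounds it from above. With theta(n) <= n ln 4 this
  leaves the constant 1.3864 - 1 - 0.607, which is below -0.213; the slack absorbs the lower-order
  terms from 4096 on.\<close>

lemma mertens_sum_le:
  assumes "4096 \<le> n"
  shows "mertens_sum n \<le> ln (real n) - 213 / 1000"
proof -
  \<comment> \<open>Without the contribution of the proper powers of 2, 3 and 5 the bound would be too weak at 4096.\<close>
  define e where "e p = (\<Sum>i=2..9. if p = 2 \<or> p = 3 \<and> i \<le> 6 \<or> p = 5 \<and> i \<le> 4
    then n div p ^ i else 0)" for p
  define x where "x = real n"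
  have x: "4096 \<le> x" using assms by (simp add: x_def)
  have mult: "x / real p - 1 + real (e p) \<le> real (multiplicity p (fact n :: nat))" if "p \<in> primes_le n" for p
  proof -
    have p: "prime p" using that by (simp add: primes_le_def)
    have "e p \<le> (\<Sum>i=2..9. n div p ^ i)"
      unfolding e_def by (intro sum_mono) auto
    then have "n div p + e p \<le> (\<Sum>i=1..9. n div p ^ i)"
      by (subst sum.atLeast_Suc_atMost[of 1 9]) (auto simp: numeral_2_eq_2)
    also have "\<dots> \<le> multiplicity p (fact n :: nat)" using p by (rule multiplicity_fact_ge)
    finally have "real (n div p) + real (e p) \<le> real (multiplicity p (fact n :: nat))"
      by (simp flip: of_nat_add)
    moreover have "x / real p - 1 \<le> real (n div p)"
    proof -
      have "n \<le> p * (n div p + 1)"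
        using dividend_less_times_div[of p n] prime_gt_0_nat[OF p] by simp
      then have "x \<le> real p * (real (n div p) + 1)"
        unfolding x_def by (metis of_nat_1 of_nat_add of_nat_le_iff of_nat_mult)
      then show ?thesis using prime_gt_0_nat[OF p] by (simp add: field_simps)
    qed
    ultimately show ?thesis by linarith
  qed
  have "(\<Sum>p\<in>primes_le n. (x / real p - 1 + real (e p)) * ln (real p))
      \<le> (\<Sum>p\<in>primes_le n. real (multiplicity p (fact n :: nat)) * ln (real p))"
    by (intro sum_mono mult_right_mono mult) (auto dest!: primes_le_ge_2)
  also have "\<dots> = ln (fact n)"
    using ln_eq_sum_multiplicity[of "fact n" "primes_le n"]
    by (simp add: prime_factors_fact_eq[symmetric] in_prime_factors_iff)
  also have "(\<Sum>p\<in>primes_le n. (x / real p - 1 + real (e p)) * ln (real p))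
      = x * mertens_sum n - theta n + (\<Sum>p\<in>primes_le n. real (e p) * ln (real p))"
    by (simp add: mertens_sum_def theta_def algebra_simps sum.distrib sum_subtractf sum_distrib_left)
  also have "(\<Sum>p\<in>primes_le n. real (e p) * ln (real p)) = (\<Sum>p\<in>{2, 3, 5}. real (e p) * ln (real p))"
    using assms by (intro sum.mono_neutral_right) (auto simp: primes_le_def e_def)
  finally have main: "x * mertens_sum n \<le> ln (fact n) + theta n
      - (real (e 2) * ln 2 + real (e 3) * ln 3 + real (e 5) * ln 5)" by simp
  have fl: "(x - real d + 1) / real d \<le> real (n div d)" if "0 < d" for d
  proof -
    have "n + 1 \<le> d * (n div d + 1)"
      using dividend_less_times_div[of d n] that by simp
    then have "x + 1 \<le> real d * (real (n div d) + 1)"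
      unfolding x_def by (metis of_nat_1 of_nat_add of_nat_le_iff of_nat_mult)
    then show ?thesis using that by (simp add: field_simps)
  qed
  have iv: "{2..9::nat} = {2,3,4,5,6,7,8,9}" by auto
  \<comment> \<open>Here 498/1000 is slightly less than 1/4 + 1/8 + ... + 1/512, and each of the
    eight floors loses less than 1. The bounds for 3 and 5 arise in the same way from five and three
    powers.\<close>
  have "498 / 1000 * x - 8 \<le> real (e 2)"
  proof -
    have "real (e 2) = real (n div 4) + real (n div 8) + real (n div 16) + real (n div 32) + real (n div 64)
        + real (n div 128) + real (n div 256) + real (n div 512)"
      by (simp add: e_def iv)
    then show ?thesis
      using fl[of 4, simplified] fl[of 8, simplified] fl[of 16, simplified] fl[of 32, simplified]
        fl[of 64, simplified] fl[of 128, simplified] fl[of 256, simplified] fl[of 512, simplified] x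
      by linarith
  qed
  then have "(498 / 1000 * x - 8) * (6931 / 10000) \<le> real (e 2) * ln 2"
    using ln_bounds_small x by (intro mult_mono) auto
  moreover have "1659 / 10000 * x - 5 \<le> real (e 3)"
  proof -
    have "real (e 3) = real (n div 9) + real (n div 27) + real (n div 81) + real (n div 243) + real (n div 729)"
      by (simp add: e_def iv)
    then show ?thesis
      using fl[of 9, simplified] fl[of 27, simplified] fl[of 81, simplified]
        fl[of 243, simplified] fl[of 729, simplified] x
      by linarith
  qed
  then have "(1659 / 10000 * x - 5) * (10986 / 10000) \<le> real (e 3) * ln 3"
    using ln_bounds_small x by (intro mult_mono) auto
  moreover have "496 / 10000 * x - 3 \<le> real (e 5)"
  proof -
    have "real (e 5) = real (n div 25) + real (n div 125) + real (n div 625)"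
      by (simp add: e_def iv)
    then show ?thesis
      using fl[of 25, simplified] fl[of 125, simplified] fl[of 625, simplified] x
      by linarith
  qed
  then have "(496 / 10000 * x - 3) * (16094 / 10000) \<le> real (e 5) * ln 5"
    using ln_bounds_small x by (intro mult_mono) auto
  moreover have "607 / 1000 * x - 16 \<le> (498 / 1000 * x - 8) * (6931 / 10000)
      + (1659 / 10000 * x - 5) * (10986 / 10000) + (496 / 10000 * x - 3) * (16094 / 10000)"
    using x by (simp add: field_simps)
  ultimately have E: "607 / 1000 * x - 16 \<le> real (e 2) * ln 2 + real (e 3) * ln 3 + real (e 5) * ln 5"
    by linarith
  have "ln (4 :: real) = 2 * ln 2" using ln_realpow[of 2 2] by simp
  then have "ln (4 :: real) \<le> 13864 / 10000" using ln_bounds_small by simp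
  then have "x * ln 4 \<le> x * (13864 / 10000)" using x by (intro mult_left_mono) auto
  then have th: "theta n \<le> x * (13864 / 10000)" using theta_le[of n] by (simp add: x_def)
  \<comment> \<open>The tangent at 4096 makes ln x negligible against the slack in the coefficient
    of x.\<close>
  have "ln (x / 4096) \<le> x / 4096 - 1" using x by (intro ln_le_minus_one) auto
  moreover have "ln (4096 :: real) = 12 * ln 2" using ln_realpow[of 2 12] by simp
  ultimately have "ln x \<le> x / 4096 + 8" using x ln_bounds_small by (simp add: ln_div)
  moreover have "ln (fact n) \<le> x * ln x - x + 1 + ln x"
    unfolding x_def using assms by (intro ln_fact_le) simp
  ultimately have "x * mertens_sum n \<le> x * ln x - 213 / 1000 * x"
    using main E th x by linarith
  also have "\<dots> = x * (ln x - 213 / 1000)" by (simp add: algebra_simps)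
  finally show ?thesis using x by (simp add: x_def)
qed

section \<open>Chebyshev's lower bound for theta\<close>

lemma multiplicity_central_binomial:
  assumes "prime p" "p ^ k \<le> 2 * m" "2 * m < p ^ Suc k"
  shows "multiplicity p ((2 * m) choose m) \<le> k"
proof -
  have "fact (2 * m) = (fact m * fact m * ((2 * m) choose m) :: nat)"
    using binomial_fact_lemma[of m "2 * m"] by simp
  then have "multiplicity p (fact (2 * m) :: nat)
      = multiplicity p (fact m :: nat) + multiplicity p (fact m :: nat) + multiplicity p ((2 * m) choose m)"
    using assms(1) by (simp add: prime_elem_multiplicity_mult_distrib)
  moreover have "multiplicity p (fact (2 * m) :: nat) = (\<Sum>i=1..k. 2 * m div p ^ i)"
    using assms by (intro multiplicity_fact) auto
  \<comment> \<open>Each of the k terms floor(2m/p^i) - 2 floor(m/p^i) is at most 1.\<close>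
  moreover have "\<dots> \<le> (\<Sum>i=1..k. m div p ^ i + m div p ^ i + 1)"
  proof (intro sum_mono)
    fix i
    have "0 < p ^ i" using assms(1) by (simp add: prime_gt_0_nat)
    then have "m < p ^ i + p ^ i * (m div p ^ i)" by (rule dividend_less_times_div)
    then have "2 * m < (m div p ^ i + m div p ^ i + 2) * p ^ i" by (simp add: algebra_simps)
    then have "2 * m div p ^ i < m div p ^ i + m div p ^ i + 2" by (rule less_mult_imp_div_less)
    then show "2 * m div p ^ i \<le> m div p ^ i + m div p ^ i + 1" by simp
  qed
  moreover have "multiplicity p (fact m :: nat) = (\<Sum>i=1..k. m div p ^ i)"
    using assms by (intro multiplicity_fact) auto
  moreover have "(\<Sum>i=1..k. m div p ^ i + m div p ^ i + 1)
      = (\<Sum>i=1..k. m div p ^ i) + (\<Sum>i=1..k. m div p ^ i) + k"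
    by (simp only: sum.distrib) simp
  ultimately show ?thesis by linarith
qed

text \<open>The central coefficient is at least 4^m / (2m). Each prime power in it is at most 2m,
  and a prime with p * p > 2m occurs at most once, so only primes up to the square root cost an
  additional ln (2m).\<close>

lemma theta_even_ge:
  assumes "1 \<le> m"
  shows "real (2 * m) * ln 2 - sqrt (real (2 * m)) * ln (real (2 * m)) \<le> theta (2 * m)"
proof -
  define N where "N = 2 * m"
  define B where "B = {p. prime p \<and> p * p \<le> N}"
  have B: "B \<subseteq> primes_le N" 
    by (auto simp: B_def primes_le_def intro: order_trans[rotated])
  have N: "2 \<le> N" using assms by (simp add: N_def)
  have lnN: "0 \<le> ln (real N)" using N by simp
  have term_le: "real (multiplicity p (N choose m)) * ln (real p)
      \<le> ln (real p) + (if p \<in> B then ln (real N) else 0)" if "p \<in> primes_le N" for p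
  proof -
    have p: "prime p" "2 \<le> p" using that by (auto simp: primes_le_def prime_ge_2_nat)
    obtain k where k: "p ^ k \<le> N" "N < p ^ (k + 1)"
      using ex_power_ivl1[of p N] p N by auto
    have v: "multiplicity p (N choose m) \<le> k"
      unfolding N_def using k by (intro multiplicity_central_binomial p) (auto simp: N_def)
    have lnp: "0 \<le> ln (real p)" using p by simp
    show ?thesis
    proof (cases "p \<in> B")
      case True
      have "real (multiplicity p (N choose m)) * ln (real p) \<le> real k * ln (real p)"
        using v lnp by (intro mult_right_mono) auto
      also have "\<dots> = ln (real (p ^ k))" using p by (simp add: ln_realpow)
      also have "\<dots> \<le> ln (real N)" using k p by (intro ln_mono) (auto simp flip: of_nat_power)
      finally show ?thesis using True lnp by simp
    next
      case False
      have "k \<le> 1"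
      proof (rule ccontr)
        assume "\<not> k \<le> 1"
        then have "p ^ 2 \<le> p ^ k" using p by (intro power_increasing) auto
        then show False using False k p by (simp add: B_def power2_eq_square)
      qed
      then have "real (multiplicity p (N choose m)) * ln (real p) \<le> 1 * ln (real p)"
        using v lnp by (intro mult_right_mono) auto
      then show ?thesis using False by simp
    qed
  qed
  have "0 < N choose m" using assms by (simp add: N_def)
  have "(N choose m) dvd fact N"
    using binomial_fact_lemma[of m N] assms by (metis N_def dvd_triv_right le_add1 mult_2)
  then have pf: "prime_factors (N choose m) \<subseteq> primes_le N"
    using dvd_prime_factors[of "fact N" "N choose m"] by (simp add: prime_factors_fact_eq)
  have "ln (real (N choose m)) = (\<Sum>p\<in>primes_le N. real (multiplicity p (N choose m)) * ln (real p))"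
    using \<open>0 < N choose m\<close> pf by (intro ln_eq_sum_multiplicity) (auto simp: primes_le_def)
  also have "\<dots> \<le> (\<Sum>p\<in>primes_le N. ln (real p) + (if p \<in> B then ln (real N) else 0))"
    by (intro sum_mono term_le)
  also have "\<dots> = theta N + real (card B) * ln (real N)"
    using B by (simp add: sum.distrib theta_def sum.If_cases Int_absorb1)
  finally have 1: "ln (real (N choose m)) \<le> theta N + real (card B) * ln (real N)" .
  have "4 ^ m / real N \<le> real (N choose m)"
    using central_binomial_lower_bound[of m] assms by (simp add: N_def)
  then have "ln (4 ^ m / real N) \<le> ln (real (N choose m))"
    using N by (intro ln_mono) auto
  moreover have "ln (4 :: real) = 2 * ln 2" using ln_realpow[of 2 2] by simp
  ultimately have 2: "real N * ln 2 - ln (real N) \<le> ln (real (N choose m))"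
    using N by (simp add: ln_div ln_realpow N_def)
  define s where "s = nat \<lfloor>sqrt (real N)\<rfloor>"
  \<comment> \<open>Starting the interval at 2 leaves room for one more ln N, the one lost in the
    lower bound of the central coefficient.\<close>
  have "B \<subseteq> {2..s}"
  proof
    fix p assume "p \<in> B"
    then have "2 \<le> p" "real p ^ 2 \<le> real N"
      by (auto simp: B_def prime_ge_2_nat power2_eq_square simp flip: of_nat_mult)
    then show "p \<in> {2..s}" by (auto simp: s_def le_nat_floor real_le_rsqrt)
  qed
  then have "card B \<le> card {2..s}" by (intro card_mono) auto
  moreover have "1 \<le> s" unfolding s_def using N by (simp add: le_nat_floor)
  ultimately have "card B + 1 \<le> s" by simp
  moreover have "real s \<le> sqrt (real N)" unfolding s_def by (simp add: of_nat_floor)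
  ultimately have "real (card B) + 1 \<le> sqrt (real N)" by linarith
  then have "(real (card B) + 1) * ln (real N) \<le> sqrt (real N) * ln (real N)"
    using lnN by (intro mult_right_mono)
  then have "real N * ln 2 - sqrt (real N) * ln (real N) \<le> theta N"
    using 1 2 by (simp add: algebra_simps)
  then show ?thesis by (simp add: N_def)
qed

text \<open>With the tangent of ln at 64 = sqrt 4096 and \<open>64 * y <= y * y\<close>, the error
  term becomes a multiple of \<open>y * y\<close>. About 0.563 is left of ln 2, enough for 11/20 and
  the constant, which bounds ln 5 from above.\<close>

lemma theta_ge:
  assumes "4096 \<le> n"
  shows "11 / 20 * real n \<le> theta n - 3219 / 2000"
proof -
  define m where "m = n div 2"
  define y where "y = sqrt (real (2 * m))"
  have m: "2048 \<le> m" using assms by (simp add: m_def)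
  have y2: "y * y = real (2 * m)" by (simp add: y_def)
  have "sqrt (64\<^sup>2) \<le> y" unfolding y_def using m by (intro real_sqrt_le_mono) simp
  then have y: "64 \<le> y" by simp
  have "ln (real (2 * m)) = 2 * ln y"
    using y by (simp only: y2[symmetric]) (simp add: ln_mult)
  moreover have "ln (y / 64) \<le> y / 64 - 1" using y by (intro ln_le_minus_one) auto
  moreover have "ln (64 :: real) = 6 * ln 2" using ln_realpow[of 2 6] by simp
  ultimately have "ln (real (2 * m)) \<le> 2 * (y / 64 + (31592 / 10000))"
    using y ln_bounds_small(2) by (simp add: ln_div)
  then have "y * ln (real (2 * m)) \<le> y * (2 * (y / 64 + (31592 / 10000)))"
    using y by (intro mult_left_mono) auto
  then have "y * ln (real (2 * m)) \<le> y * y / 32 + 63184 / 10000 * y"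
    by (simp add: algebra_simps)
  moreover have "y * y * (6931 / 10000) \<le> y * y * ln 2"
    using ln_bounds_small(1) by (intro mult_left_mono) auto
  moreover have "y * y * ln 2 - y * ln (real (2 * m)) \<le> theta (2 * m)"
    unfolding y2 using theta_even_ge[of m] m by (simp add: y_def)
  moreover have "theta (2 * m) \<le> theta n" by (rule theta_mono) (simp add: m_def)
  moreover have "real n \<le> y * y + 1"
  proof -
    have "n \<le> 2 * m + 1" unfolding m_def by linarith
    then show ?thesis unfolding y2 by (simp flip: of_nat_Suc)
  qed
  moreover have "64 * y \<le> y * y" using y by (intro mult_right_mono) auto
  ultimately show ?thesis using y by linarith
qed

section \<open>The comparison of the Euler product with the logarithm of theta\<close>

text \<open>Cutting the exponent 19/33 into eight equal parts makes the quadratic Taylor bound sharp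
  enough.\<close>

lemma exp_gamma_gt: "71 / 40 < exp (euler_mascheroni :: real)"
proof -
  have "1 + x + x\<^sup>2 / 2 \<le> exp x" if "0 \<le> x" for x :: real
    using exp_lower_Taylor_quadratic[OF that] .
  from this[of "19 / 264"] have "(2149 / 2000 :: real) \<le> exp (19 / 264)"
    by (simp add: power2_eq_square)
  then have "(2149 / 2000 :: real) ^ 8 \<le> exp (19 / 264) ^ 8"
    by (intro power_mono) auto
  also have "exp (19 / 264) ^ 8 = exp (19 / 33 :: real)"
    by (simp flip: exp_of_nat_mult)
  also have "\<dots> < exp euler_mascheroni"
    using euler_mascheroni_gt_19_over_33 by simp
  finally have "(2149 / 2000 :: real) ^ 8 < exp euler_mascheroni" .
  then show ?thesis by (simp add: power_divide)
qed

text \<open>Splitting off a power of 2 leaves \<open>w\<close> close to 1, where 2(w - 1)/(w + 1) is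
  a sharp lower bound of ln w.\<close>

lemma ln_ge_two_power:
  assumes "w \<ge> 1" "2 ^ m * w \<le> (y :: real)"
  shows "real m * (6931 / 10000) + 2 * (w - 1) / (w + 1) \<le> ln y"
proof -
  have "2 * (w - 1) / (w + 1) \<le> ln w"
    using ln_inverse_approx_ge[of 1 w] assms(1) by (cases "w = 1") (auto simp: add.commute)
  moreover have "real m * (6931 / 10000) \<le> real m * ln 2"
    using ln_bounds_small(1) by (intro mult_left_mono) auto
  moreover have "ln (2 ^ m * w) = real m * ln 2 + ln w"
    using assms by (simp add: ln_mult ln_realpow)
  moreover have "ln (2 ^ m * w) \<le> ln y"
    using assms by (intro ln_mono mult_pos_pos) auto
  ultimately show ?thesis by linarith
qed

text \<open>Both sides increase with \<open>x\<close>, so the product at the right end against theta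
  at the left end settles the whole block. It extends to \<open>Suc b\<close>, which is even and not
  prime.\<close>

lemma block_bound:
  assumes "numeric_bounds a q l P T M" "numeric_bounds b q' l' P' T' M'" "odd b"
    and "a \<le> x" "x \<le> Suc b" "1 \<le> w"
    and "2 ^ m * w \<le> real T / 1000000 - 3219 / 2000"
    and "4 / 5 * (real P' / 1000000) < 71 / 40 * (real m * (6931 / 10000) + 2 * (w - 1) / (w + 1))"
  shows "4 / 5 * euler_prod x < 71 / 40 * ln (theta x - 3219 / 2000)"
proof -
  have "euler_prod x \<le> euler_prod (Suc b)" using assms(5) by (rule euler_prod_mono)
  also have "\<dots> \<le> real P' / 1000000"
    using numeric_bounds_Suc[OF assms(2,3)] by (simp add: numeric_bounds_def)
  finally have P: "4 / 5 * euler_prod x \<le> 4 / 5 * (real P' / 1000000)" by simp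
  have "real T / 1000000 \<le> theta a" using assms(1) by (simp add: numeric_bounds_def)
  also have "\<dots> \<le> theta x" using assms(4) by (rule theta_mono)
  finally have "2 ^ m * w \<le> theta x - 3219 / 2000" using assms(7) by simp
  then have "71 / 40 * (real m * (6931 / 10000) + 2 * (w - 1) / (w + 1))
      \<le> 71 / 40 * ln (theta x - 3219 / 2000)"
    using assms(6) by (intro mult_left_mono ln_ge_two_power) auto
  with P assms(8) show ?thesis by (meson le_less_trans less_le_trans)
qed

text \<open>In each block \<open>2 ^ m * w\<close> is a rational lower estimate of theta at the left
  end minus 3219/2000. The blocks lengthen as the inequality gains room.\<close>

lemma euler_prod_lt_finite_range:
  assumes "19 \<le> x" "x \<le> 4096"
  shows "4 / 5 * euler_prod x < 71 / 40 * ln (theta x - 3219 / 2000)"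
proof -
  consider "19 \<le> x" "x \<le> 22" | "23 \<le> x" "x \<le> 30" | "31 \<le> x" "x \<le> 46" | "47 \<le> x" "x \<le> 88"
    | "89 \<le> x" "x \<le> 206" | "205 \<le> x" "x \<le> 618"
    | "617 \<le> x" "x \<le> 2702" | "2701 \<le> x" "x \<le> 4096"
    using assms by linarith
  then show ?thesis
  proof cases
    case 1
    then show ?thesis
      by (intro block_bound[OF numeric_bounds_19 numeric_bounds_21, where m = 3 and w = "1805 / 1000"]) simp_all
  next
    case 2
    then show ?thesis
      by (intro block_bound[OF numeric_bounds_23 numeric_bounds_29, where m = 4 and w = "1098 / 1000"]) simp_all
  next
    case 3
    then show ?thesis
      by (intro block_bound[OF numeric_bounds_31 numeric_bounds_45, where m = 4 and w = "1521 / 1000"]) simp_all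
  next
    case 4
    then show ?thesis
      by (intro block_bound[OF numeric_bounds_47 numeric_bounds_87, where m = 5 and w = "1226 / 1000"]) simp_all
  next
    case 5
    then show ?thesis
      by (intro block_bound[OF numeric_bounds_89 numeric_bounds_205, where m = 6 and w = "1208 / 1000"]) simp_all
  next
    case 6
    then show ?thesis
      by (intro block_bound[OF numeric_bounds_205 numeric_bounds_617, where m = 7 and w = "14565 / 10000"]) simp_all
  next
    case 7
    then show ?thesis
      by (intro block_bound[OF numeric_bounds_617 numeric_bounds_2701, where m = 9 and w = "114 / 100"]) simp_all
  next
    case 8
    then show ?thesis
      by (intro block_bound[OF numeric_bounds_2701 numeric_bounds_4095, where m = 11 and w = "12 / 10"]) simp_all
  qed
qed

text \<open>
  Partial summation as an induction on \<open>n\<close>: the step goes through because the claim carries the term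
  \<open>G n / ln n\<close>, where \<open>G n \<le> 0\<close> is the defect in the assumed bound. The telescoping term
  \<open>1/a - 1/n\<close> absorbs the difference between \<open>-ln (1 - 1/p)\<close> and \<open>1/p\<close>.
\<close>

lemma ln_euler_prod_le:
  assumes "2 \<le> a" "a \<le> n"
    and "\<And>m. a \<le> m \<Longrightarrow> mertens_sum m - mertens_sum a \<le> ln (real m) - ln (real a) + c"
  shows "ln (euler_prod n) \<le> ln (euler_prod a) + ln (ln (real n)) - ln (ln (real a))
    + c / ln (real a) + 1 / real a"
proof -
  define G where "G m = mertens_sum m - mertens_sum a - (ln (real m) - ln (real a) + c)" for m
  have G: "G m \<le> 0" if "a \<le> m" for m using assms(3)[OF that] by (simp add: G_def)
  have "ln (euler_prod n) \<le> ln (euler_prod a) + (G n / ln (real n) + ln (ln (real n)) - ln (ln (real a))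
      + c / ln (real a)) + (1 / real a - 1 / real n)"
    using assms(2)
  proof (induction n rule: dec_induct)
    case base
    then show ?case by (simp add: G_def)
  next
    case (step n)
    define x where "x = real n"
    define y where "y = real (Suc n)"
    define \<delta> where "\<delta> = (if prime (Suc n) then 1 / y else 0)"
    have xy: "2 \<le> x" "x < y" "y = x + 1" using step assms(1) by (auto simp: x_def y_def)
    have ln: "0 < ln x" "ln x < ln y" using xy by auto
    have E: "ln (euler_prod (Suc n)) \<le> ln (euler_prod n) + \<delta> + (1 / x - 1 / y)"
    proof (cases "prime (Suc n)")
      case True
      then have "euler_prod (Suc n) = euler_prod n * (y / x)"
        by (simp add: euler_prod_def primes_le_Suc x_def y_def)
      then have "ln (euler_prod (Suc n)) = ln (euler_prod n) + ln (y / x)"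
        using ln_mult_pos[of "euler_prod n" "y / x"] euler_prod_pos[of n] xy(1,2) by simp
      moreover have "ln (y / x) \<le> y / x - 1" using xy by (intro ln_le_minus_one) auto
      moreover have "y / x - 1 = 1 / x" using xy by (simp add: field_simps)
      ultimately show ?thesis using True by (simp add: \<delta>_def)
    next
      case False
      then have "euler_prod (Suc n) = euler_prod n" by (simp add: euler_prod_def primes_le_Suc)
      moreover have "1 / y \<le> 1 / x" using xy by (simp add: field_simps)
      ultimately show ?thesis using False by (simp add: \<delta>_def)
    qed
    have "mertens_sum (Suc n) = mertens_sum n + \<delta> * ln y"
      by (simp add: mertens_sum_def primes_le_Suc \<delta>_def y_def)
    then have "G (Suc n) = G n + \<delta> * ln y - (ln y - ln x)"
      by (simp add: G_def x_def y_def)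
    then have 1: "G (Suc n) / ln y = G n / ln y + \<delta> - (1 - ln x / ln y)"
      using ln by (simp add: add_divide_distrib diff_divide_distrib)
    \<comment> \<open>Dividing a nonpositive number by the larger logarithm moves it up; this is
      where the assumed bound on the Mertens sum enters.\<close>
    have 2: "G n / ln x \<le> G n / ln y"
      using ln G[of n] step by (intro divide_left_mono_neg) auto
    have "ln (ln x / ln y) \<le> ln x / ln y - 1" using ln by (intro ln_le_minus_one) auto
    then have 3: "1 - ln x / ln y \<le> ln (ln y) - ln (ln x)" using ln by (simp add: ln_div)
    show ?case using step.IH E 1 2 3 unfolding x_def[symmetric] y_def[symmetric] by linarith
  qed
  moreover have "G n / ln (real n) \<le> 0"
    using G assms by (intro divide_nonpos_nonneg) auto
  moreover have "0 \<le> 1 / real n" by simp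
  ultimately show ?thesis by linarith
qed

text \<open>The left side is at most 1.6373 ln n and the right side at least 1.775 (ln n - 0.6);
  these lines cross before ln n reaches ln 4096, about 8.318.\<close>

lemma euler_prod_lt_large:
  assumes "4096 \<le> n"
  shows "4 / 5 * euler_prod n < 71 / 40 * ln (theta n - 3219 / 2000)"
proof -
  define L where "L = ln (4096 :: real)"
  have "L = 12 * ln 2" using ln_realpow[of 2 12] by (simp add: L_def)
  then have L: "83172 / 10000 \<le> L" "L \<le> 83184 / 10000" using ln_bounds_small by auto
  have b: "numeric_bounds 4096 4093 8304081 14846661 4020266180 6991942"
    using numeric_bounds_Suc[OF numeric_bounds_4095] by simp
  define x where "x = ln (real n)"
  have x: "L \<le> x" unfolding L_def x_def using assms by (intro ln_mono) auto
  \<comment> \<open>The constant exceeds ln 4096 - 0.213 - 6.991942, where the last number is the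
    computed lower bound of the sum at 4096.\<close>
  have "mertens_sum m - mertens_sum 4096 \<le> ln (real m) - ln (real 4096) + 1114 / 1000"
    if "4096 \<le> m" for m
    using mertens_sum_le[OF that] b L by (simp add: numeric_bounds_def L_def)
  then have "ln (euler_prod n) \<le> ln (euler_prod 4096) + ln x - ln L + (1114 / 1000) / L + 1 / 4096"
    using ln_euler_prod_le[of 4096 n "1114 / 1000"] assms by (simp add: L_def x_def)
  also have "(1114 / 1000) / L \<le> (1114 / 1000) / (83172 / 10000)"
    using L by (intro divide_left_mono) auto
  finally have "ln (euler_prod n) \<le> ln (euler_prod 4096) + ln x - ln L + 1342 / 10000" by simp
  then have "exp (ln (euler_prod n)) \<le> exp (ln (euler_prod 4096) + ln x - ln L + 1342 / 10000)"
    by simp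
  then have 0: "euler_prod n \<le> euler_prod 4096 * x / L * exp (1342 / 10000)"
    using euler_prod_pos L x by (simp add: exp_add exp_diff)
  \<comment> \<open>An upper bound of exp t comes from exp (-t) >= (1 - t/4)^4.\<close>
  have 1: "exp (1342 / 10000 :: real) \<le> 11465 / 10000"
  proof -
    have "1 - 3355 / 100000 \<le> exp (- (3355 / 100000) :: real)"
      using exp_ge_add_one_self[of "- (3355 / 100000)"] by simp
    then have "(1 - 3355 / 100000) ^ 4 \<le> exp (- (3355 / 100000) :: real) ^ 4"
      by (intro power_mono) auto
    also have "\<dots> = exp (- (1342 / 10000))" by (simp flip: exp_of_nat_mult)
    finally have "1 / exp (- (1342 / 10000) :: real) \<le> 1 / (1 - 3355 / 100000) ^ 4"
      by (intro divide_left_mono) auto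
    then show ?thesis by (simp add: exp_minus field_simps)
  qed
  note 0
  also have "euler_prod 4096 * x / L * exp (1342 / 10000) \<le> euler_prod 4096 * x / L * (11465 / 10000)"
    using 1 euler_prod_pos[of 4096] L x by (intro mult_left_mono) auto
  also have "\<dots> \<le> (14846661 / 1000000) * x / (83172 / 10000) * (11465 / 10000)"
    using b L x euler_prod_pos[of 4096]
    by (intro mult_right_mono frac_le mult_mono) (auto simp: numeric_bounds_def)
  finally have 1: "4 / 5 * euler_prod n \<le> 16373 / 10000 * x" using x L by simp
  \<comment> \<open>Since theta(n) - 3219/2000 is at least 11/20 n, passing from ln n to its
    logarithm loses at most ln (20/11).\<close>
  have "ln (20 / 11 :: real) \<le> 6 / 10"
    using ln_approx_bounds[of "20 / 11" 3] by (simp add: eval_nat_numeral)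
  then have "x - 6 / 10 \<le> ln (11 / 20 * real n)"
    using assms by (simp add: x_def ln_mult ln_div)
  also have "\<dots> \<le> ln (theta n - 3219 / 2000)"
    using theta_ge[OF assms] assms by (intro ln_mono) auto
  finally show ?thesis using 1 x L by simp
qed

section \<open>Sums of divisors\<close>

text \<open>The limit of \<open>sigma (p ^ a) / p ^ a\<close> as the exponent grows, for prime
  \<open>p\<close>.\<close>

definition euler_factor :: "nat \<Rightarrow> real" where
  "euler_factor p = real p / (real p - 1)"

lemma euler_factor_ge_1: "2 \<le> p \<Longrightarrow> 1 \<le> euler_factor p"
  by (simp add: euler_factor_def)

lemma euler_factor_antimono: "2 \<le> p \<Longrightarrow> p \<le> q \<Longrightarrow>
    euler_factor q \<le> euler_factor p"
  by (simp add: euler_factor_def divide_simps algebra_simps)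

lemma truncated_euler_factor_bounds:
  assumes "2 \<le> p"
  shows "0 \<le> euler_factor p * (1 - 1 / real p ^ k)"
    and "euler_factor p * (1 - 1 / real p ^ k) \<le> euler_factor p"
proof -
  have "1 \<le> real p ^ k" using assms by (intro one_le_power) simp
  then have "0 \<le> 1 - 1 / real p ^ k" "1 - 1 / real p ^ k \<le> 1"
    by (simp_all add: divide_le_eq)
  moreover have "0 \<le> euler_factor p" using euler_factor_ge_1[OF assms] by simp
  ultimately show "0 \<le> euler_factor p * (1 - 1 / real p ^ k)"
    and "euler_factor p * (1 - 1 / real p ^ k) \<le> euler_factor p"
    by (simp_all add: mult_left_le)
qed

text \<open>Every divisor of \<open>m * n\<close> is a product of a divisor of \<open>m\<close> and
  one of \<open>n\<close>; different pairs may give the same product, hence the inequality.\<close>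

lemma sigma_mult_le:
  assumes "0 < m" "0 < n"
  shows "sigma (m * n) \<le> sigma m * sigma n"
proof -
  have fin: "finite {d. d dvd m}" "finite {d. d dvd n}" using assms by auto
  have "{d. d dvd m * n} \<subseteq> (\<lambda>(a, b). a * b) ` ({d. d dvd m} \<times> {d. d dvd n})"
  proof
    fix d assume "d \<in> {d. d dvd m * n}"
    then obtain a b where "d = a * b" "a dvd m" "b dvd n"
      using division_decomp[of d m n] by auto
    then show "d \<in> (\<lambda>(a, b). a * b) ` ({d. d dvd m} \<times> {d. d dvd n})"
      by (intro image_eqI[of _ _ "(a, b)"]) auto
  qed
  then have "sigma (m * n) \<le> sum (\<lambda>d. d) ((\<lambda>(a, b). a * b) ` ({d. d dvd m} \<times> {d. d dvd n}))"
    unfolding sigma_def using fin by (intro sum_mono2) auto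
  also have "\<dots> \<le> sum ((\<lambda>d. d) \<circ> (\<lambda>(a, b). a * b)) ({d. d dvd m} \<times> {d. d dvd n})"
    using fin by (intro sum_image_le) auto
  also have "\<dots> = sigma m * sigma n"
    by (simp add: sigma_def sum_product sum.cartesian_product case_prod_unfold comp_def)
  finally show ?thesis .
qed

lemma sigma_prime_power:
  assumes "prime p"
  shows "real (sigma (p ^ a)) = real (p ^ a) * (euler_factor p * (1 - 1 / real p ^ Suc a))"
proof -
  have p: "1 < p" using assms by (rule prime_gt_1_nat)
  have "{d. d dvd p ^ a} = (\<lambda>i. p ^ i) ` {..a}"
    using divides_primepow_nat[OF assms] by auto
  moreover have "inj_on (\<lambda>i. p ^ i) {..a}" using p by (auto simp: inj_on_def)
  ultimately have "sigma (p ^ a) = (\<Sum>i\<le>a. p ^ i)" by (simp add: sigma_def sum.reindex)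
  then have "real (sigma (p ^ a)) = (\<Sum>i<Suc a. real p ^ i)" by (simp add: lessThan_Suc_atMost)
  also have "\<dots> = (real p ^ Suc a - 1) / (real p - 1)" using p by (intro geometric_sum) simp
  also have "\<dots> = real (p ^ a) * (euler_factor p * (1 - 1 / real p ^ Suc a))"
    using p by (simp add: euler_factor_def field_simps)
  finally show ?thesis .
qed

lemma sigma_prod_prime_powers_le:
  assumes "finite A" "\<And>p. p \<in> A \<Longrightarrow> prime p"
  shows "sigma (\<Prod>p\<in>A. p ^ f p) \<le> (\<Prod>p\<in>A. sigma (p ^ f p))"
  using assms
proof (induction A)
  case empty
  have "{d :: nat. d dvd 1} = {1}" by auto
  then show ?case by (simp add: sigma_def)
next
  case (insert p A)
  have "sigma (p ^ f p * (\<Prod>p\<in>A. p ^ f p)) \<le> sigma (p ^ f p) * sigma (\<Prod>p\<in>A. p ^ f p)"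
    using insert by (intro sigma_mult_le prod_pos) (auto simp: prime_gt_0_nat)
  also have "\<dots> \<le> sigma (p ^ f p) * (\<Prod>p\<in>A. sigma (p ^ f p))"
    using insert by (intro mult_left_mono) auto
  finally show ?case using insert by simp
qed

lemma sigma_le_prod:
  assumes "0 < N"
  shows "real (sigma N) \<le> real N
    * (\<Prod>p\<in>prime_factors N. euler_factor p * (1 - 1 / real p ^ Suc (multiplicity p N)))"
proof -
  let ?A = "prime_factors N" and ?v = "\<lambda>p. multiplicity p N"
  have N: "N = (\<Prod>p\<in>?A. p ^ ?v p)" using assms by (intro prime_factorization_nat) auto
  have "sigma (\<Prod>p\<in>?A. p ^ ?v p) \<le> (\<Prod>p\<in>?A. sigma (p ^ ?v p))"
    by (intro sigma_prod_prime_powers_le) auto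
  then have "real (sigma N) \<le> real (\<Prod>p\<in>?A. sigma (p ^ ?v p))"
    by (simp only: N[symmetric] of_nat_le_iff)
  also have "\<dots> = (\<Prod>p\<in>?A. real (p ^ ?v p)
      * (euler_factor p * (1 - 1 / real p ^ Suc (?v p))))"
    unfolding of_nat_prod by (intro prod.cong refl sigma_prime_power) auto
  also have "\<dots> = real (\<Prod>p\<in>?A. p ^ ?v p)
      * (\<Prod>p\<in>?A. euler_factor p * (1 - 1 / real p ^ Suc (?v p)))"
    unfolding of_nat_prod by (rule prod.distrib)
  finally show ?thesis by (simp only: N[symmetric])
qed

lemma euler_prod_eq: "euler_prod n = (\<Prod>p\<in>primes_le n. euler_factor p)"
  by (simp add: euler_prod_def euler_factor_def)

lemma in_prime_factors_ge_2: "p \<in> prime_factors (N :: nat) \<Longrightarrow> 2 \<le> p"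
  using in_prime_factors_imp_prime prime_ge_2_nat by blast

lemma sigma_le_euler_factors:
  assumes "0 < N"
  shows "real (sigma N) \<le> real N * (\<Prod>p\<in>prime_factors N. euler_factor p)"
proof -
  have "(\<Prod>p\<in>prime_factors N. euler_factor p * (1 - 1 / real p ^ Suc (multiplicity p N)))
      \<le> (\<Prod>p\<in>prime_factors N. euler_factor p)"
    by (intro prod_mono conjI truncated_euler_factor_bounds in_prime_factors_ge_2)
  then show ?thesis
    using sigma_le_prod[OF assms] by (meson mult_left_mono of_nat_0_le_iff order_trans)
qed

text \<open>A low power of one prime keeps its factor away from the limit
  \<open>euler_factor q\<close>. This saving serves small N, where the full product is too
  large.\<close>

lemma sigma_le_small_multiplicity:
  assumes "0 < N" "q \<in> prime_factors N" "multiplicity q N < a"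
  shows "real (sigma N) \<le> real N * ((1 - 1 / real q ^ a) * (\<Prod>p\<in>prime_factors N. euler_factor p))"
proof -
  let ?g = "\<lambda>p. euler_factor p * (1 - 1 / real p ^ Suc (multiplicity p N))"
  have q: "2 \<le> q" using assms(2) by (rule in_prime_factors_ge_2)
  have "real q ^ Suc (multiplicity q N) \<le> real q ^ a"
    using assms(3) q by (intro power_increasing) auto
  then have "1 / real q ^ a \<le> 1 / real q ^ Suc (multiplicity q N)"
    using q by (intro divide_left_mono mult_pos_pos zero_less_power) auto
  then have gq: "?g q \<le> euler_factor q * (1 - 1 / real q ^ a)"
    using euler_factor_ge_1[OF q] by (intro mult_left_mono) auto
  have "(\<Prod>p\<in>prime_factors N. ?g p) = ?g q * (\<Prod>p\<in>prime_factors N - {q}. ?g p)"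
    using assms(2) by (intro prod.remove) auto
  also have "\<dots> \<le> (euler_factor q * (1 - 1 / real q ^ a))
      * (\<Prod>p\<in>prime_factors N - {q}. euler_factor p)"
    by (intro mult_mono gq prod_mono prod_nonneg conjI truncated_euler_factor_bounds q)
       (auto dest: in_prime_factors_ge_2 intro!: truncated_euler_factor_bounds simp del: power_Suc)
  also have "\<dots> = (1 - 1 / real q ^ a) * (\<Prod>p\<in>prime_factors N. euler_factor p)"
    using assms(2) by (simp add: prod.remove[of _ q])
  finally show ?thesis
    using sigma_le_prod[OF assms(1)] by (meson mult_left_mono of_nat_0_le_iff order_trans)
qed

section \<open>Replacing the primes of N by the first primes\<close>

lemma prod_exchange_le:
  fixes f :: "'a \<Rightarrow> real"
  assumes "finite Q" "finite R" "card Q = card R" "0 \<le> c"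
    and "\<And>q. q \<in> Q \<Longrightarrow> 0 \<le> f q"
    and "\<And>q. q \<in> Q - R \<Longrightarrow> f q \<le> c" "\<And>r. r \<in> R - Q \<Longrightarrow> c \<le> f r"
  shows "prod f Q \<le> prod f R"
proof -
  \<comment> \<open>The common part cancels; what remains on the two sides is equinumerous and
    separated by \<open>c\<close>.\<close>
  have "card (Q - R) = card (R - Q)"
    using assms(1-3) by (metis card_Diff_subset_Int finite_Int inf_commute)
  then have "prod f (Q - R) \<le> c ^ card (R - Q)"
    using prod_mono[of "Q - R" f "\<lambda>_. c"] assms by simp
  also have "\<dots> \<le> prod f (R - Q)"
    using prod_mono[of "R - Q" "\<lambda>_. c" f] assms by simp
  finally have "prod f (Q \<inter> R) * prod f (Q - R) \<le> prod f (Q \<inter> R) * prod f (R - Q)"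
    using assms by (intro mult_left_mono prod_nonneg) auto
  then show ?thesis
    using prod.Int_Diff[of Q f R] prod.Int_Diff[of R f Q] assms(1,2) by (simp add: Int_commute)
qed

text \<open>The cardinality is unbounded in \<open>x\<close> and rises by at most one per step, so
  at the least \<open>x\<close> where it reaches \<open>k\<close> it equals
  \<open>k\<close>.\<close>

lemma ex_primes_le_card: "\<exists>x. card (primes_le x - {q}) = k"
proof -
  have "infinite ({p :: nat. prime p} - {q})" using primes_infinite by simp
  then obtain T where T: "finite T" "card T = k" "T \<subseteq> {p. prime p} - {q}"
    using infinite_arbitrarily_large by blast
  have "T \<subseteq> primes_le (Max (insert 0 T)) - {q}" using T by (auto simp: primes_le_def)
  then have "k \<le> card (primes_le (Max (insert 0 T)) - {q})"
    using T(2) card_mono by (metis finite_Diff finite_primes_le)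
  then have ex: "\<exists>x. k \<le> card (primes_le x - {q})" by blast
  define x where "x = (LEAST x. k \<le> card (primes_le x - {q}))"
  have 1: "k \<le> card (primes_le x - {q})" unfolding x_def by (rule LeastI_ex) (rule ex)
  have "card (primes_le x - {q}) \<le> k"
  proof (cases x)
    case (Suc y)
    then have "\<not> k \<le> card (primes_le y - {q})"
      unfolding x_def using not_less_Least[of y] by (metis lessI)
    moreover have "primes_le (Suc y) - {q} \<subseteq> insert (Suc y) (primes_le y - {q})"
      by (auto simp: primes_le_Suc split: if_splits)
    then have "card (primes_le (Suc y) - {q}) \<le> card (insert (Suc y) (primes_le y - {q}))"
      by (intro card_mono) auto
    moreover have "card (insert (Suc y) (primes_le y - {q})) \<le> Suc (card (primes_le y - {q}))"
      by (simp add: card_insert_if)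
    ultimately show ?thesis using Suc by simp
  qed simp
  with 1 show ?thesis by (intro exI[of _ x]) simp
qed

text \<open>\<open>ln_ge_two_power\<close> twice: \<open>m\<close>, \<open>w\<close> serve the inner
  logarithm and \<open>m'\<close>, \<open>w'\<close> the outer one.\<close>

lemma ln_ln_ge:
  assumes "2 ^ m * w \<le> real M" "M \<le> N" "1 \<le> w" "1 \<le> w'"
    and "2 ^ m' * w' \<le> real m * (6931 / 10000) + 2 * (w - 1) / (w + 1)"
  shows "real m' * (6931 / 10000) + 2 * (w' - 1) / (w' + 1) \<le> ln (ln (real N))"
proof (rule ln_ge_two_power)
  have "2 ^ m * w \<le> real N" using assms(1,2) by simp
  then show "2 ^ m' * w' \<le> ln (real N)"
    using ln_ge_two_power[OF assms(3), of m "real N"] assms(5) by simp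
qed fact

lemma primes_le_18: "primes_le 18 = {2, 3, 5, 7, 11, 13, 17}"
  by (simp add: primes_le_eq_filter upt_rec_numeral)

lemma pth_eq: "pth 1 = 2" "pth 2 = 3" "pth 3 = 5"
proof -
  have prime_2: "2 \<le> p" if "prime p" for p :: nat using that by (rule prime_ge_2_nat)
  have e0: "enumerate {p :: nat. prime p} 0 = 2"
    unfolding enumerate_0 by (rule Least_equality) (auto simp: prime_2)
  have e1: "enumerate {p :: nat. prime p} (Suc 0) = 3"
    unfolding enumerate_Suc''[OF primes_infinite, of 0] e0 by (rule Least_equality) auto
  have "5 \<le> p" if "prime p" "3 < p" for p :: nat
  proof (rule ccontr)
    assume "\<not> 5 \<le> p"
    then have "p = 4" using that by simp
    then show False using that by simp
  qed
  then have e2: "enumerate {p :: nat. prime p} (Suc (Suc 0)) = 5"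
    unfolding enumerate_Suc''[OF primes_infinite, of "Suc 0"] e1 by (intro Least_equality) auto
  show "pth 1 = 2" "pth 2 = 3" "pth 3 = 5"
    using e0 e1 e2 by (simp_all add: pth_def numeral_2_eq_2)
qed

section \<open>Robin's inequality\<close>

text \<open>The threshold \<open>x\<close> serves both exchanges: a prime factor outside the initial
  segment exceeds \<open>x\<close>, as \<open>q\<close> is not a prime factor. The directions differ
  because \<open>euler_factor\<close> decreases while the primes themselves increase.\<close>

lemma sigma_bounds_initial_primes:
  assumes "1 < N" "\<not> q dvd N"
  obtains x where "(\<Prod>p\<in>prime_factors N. euler_factor p)
    \<le> (\<Prod>p\<in>primes_le x - {q}. euler_factor p)"
    and "\<Prod>(primes_le x - {q}) \<le> \<Prod>(prime_factors N)"
proof -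
  let ?Q = "prime_factors N"
  obtain x where x: "card (primes_le x - {q}) = card ?Q" using ex_primes_le_card by blast
  let ?R = "primes_le x - {q}"
  have "?Q \<noteq> {}" using assms(1) by (simp add: prime_factorization_empty_iff)
  then have "card ?Q \<noteq> 0" by simp
  then have "?R \<noteq> {}" using x by (metis card.empty)
  then obtain r where "r \<in> primes_le x" by blast
  then have x2: "2 \<le> x" by (auto simp: primes_le_def dest: prime_ge_2_nat)
  have Q: "x < p" if "p \<in> ?Q - ?R" for p
    using that assms(2) by (auto simp: primes_le_def)
  have R: "2 \<le> p" "p \<le> x" if "p \<in> ?R - ?Q" for p
    using that by (auto simp: primes_le_def prime_ge_2_nat)
  have 1: "(\<Prod>p\<in>?Q. euler_factor p) \<le> (\<Prod>p\<in>?R. euler_factor p)"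
  proof (rule prod_exchange_le[where c = "euler_factor x"])
    show "0 \<le> euler_factor x" using euler_factor_ge_1[OF x2] by simp
    show "0 \<le> euler_factor p" if "p \<in> ?Q" for p
      using euler_factor_ge_1[OF in_prime_factors_ge_2[OF that]] by simp
    show "euler_factor p \<le> euler_factor x" if "p \<in> ?Q - ?R" for p
      using euler_factor_antimono[OF x2] Q[OF that] by simp
    show "euler_factor x \<le> euler_factor p" if "p \<in> ?R - ?Q" for p
      using euler_factor_antimono R[OF that] by simp
  qed (simp_all add: x)
  have "(\<Prod>p\<in>?R. real p) \<le> (\<Prod>p\<in>?Q. real p)"
    using x Q R
    by (intro prod_exchange_le[where c = "real x"]) (auto intro!: less_imp_le)
  then have 2: "\<Prod>?R \<le> \<Prod>?Q" by (simp flip: of_nat_prod)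
  from that 1 2 show thesis by blast
qed

lemma prod_prime_factors_le: "0 < N \<Longrightarrow> \<Prod>(prime_factors N) \<le> (N :: nat)"
  by (intro dvd_imp_le prod_primes_dvd) auto

lemma prod_prime_factors_mult_le:
  fixes N :: nat
  assumes "0 < N" "2 \<in> prime_factors N" "3 \<in> prime_factors N"
    and "Suc a \<le> multiplicity 2 N" "Suc b \<le> multiplicity 3 N"
  shows "2 ^ a * 3 ^ b * \<Prod>(prime_factors N) \<le> N"
proof -
  let ?c = "\<lambda>p. if p = 2 then 2 ^ a else if p = 3 then 3 ^ b else 1 :: nat"
  have "(\<Prod>p\<in>prime_factors N. ?c p) = (\<Prod>p\<in>{2, 3 :: nat}. ?c p)"
    using assms(2,3) by (intro prod.mono_neutral_right) auto
  then have "2 ^ a * 3 ^ b * \<Prod>(prime_factors N) = (\<Prod>p\<in>prime_factors N. ?c p * p)"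
    by (simp add: prod.distrib)
  also have "\<dots> \<le> (\<Prod>p\<in>prime_factors N. p ^ multiplicity p N)"
  proof (intro prod_mono conjI)
    fix p assume p: "p \<in> prime_factors N"
    then have "2 \<le> p" by (rule in_prime_factors_ge_2)
    have 1: "1 \<le> multiplicity p N" using p by (simp add: prime_factors_multiplicity)
    have "p ^ Suc (if p = 2 then a else if p = 3 then b else 0) \<le> p ^ multiplicity p N"
      using assms(4,5) 1 \<open>2 \<le> p\<close> by (intro power_increasing) auto
    then show "?c p * p \<le> p ^ multiplicity p N" by (auto split: if_splits simp: mult.commute)
  qed simp
  also have "\<dots> = N" using assms(1) by (intro prime_factorization_nat[symmetric]) auto
  finally show ?thesis .
qed

text \<open>Here \<open>71 / 40\<close> stands in for e^gamma and \<open>B\<close> for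
  \<open>ln (ln (real N))\<close>.\<close>

lemma robin_of_ln_ln_bound:
  assumes "real s \<le> real N * c" "c < 71 / 40 * B" "B \<le> ln (ln (real N))" "0 \<le> B" "0 < N"
  shows "real s < exp euler_mascheroni * real N * ln (ln (real N))"
proof -
  have "c < exp euler_mascheroni * ln (ln (real N))"
    using assms(2-4) exp_gamma_gt by (smt (verit) mult_mono exp_gt_zero)
  then have "real N * c < real N * (exp euler_mascheroni * ln (ln (real N)))"
    using assms(5) by simp
  with assms(1) show ?thesis by (simp add: mult_ac)
qed

lemma robin_large:
  assumes "q \<in> {2, 3, 5}" "19 \<le> x" "1 < N"
    and 1: "(\<Prod>p\<in>prime_factors N. euler_factor p)
    \<le> (\<Prod>p\<in>primes_le x - {q}. euler_factor p)"
    and 2: "\<Prod>(primes_le x - {q}) \<le> \<Prod>(prime_factors N)"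
  shows "real (sigma N) < exp euler_mascheroni * real N * ln (ln (real N))"
proof (rule robin_of_ln_ln_bound)
  have q: "q \<in> primes_le x" using assms(1,2) by (auto simp: primes_le_def)
  have T: "16 \<le> theta x"
    using theta_mono[OF assms(2)] numeric_bounds_19 by (simp add: numeric_bounds_def)
  have "euler_prod x = euler_factor q * (\<Prod>p\<in>primes_le x - {q}. euler_factor p)"
    unfolding euler_prod_eq using q by (intro prod.remove) auto
  \<comment> \<open>The worst case is q = 5, both for this factor and for the logarithm ln q removed
    from theta below.\<close>
  moreover have "5 / 4 \<le> euler_factor q" using assms(1) by (auto simp: euler_factor_def)
  moreover have "0 \<le> (\<Prod>p\<in>primes_le x - {q}. euler_factor p)"
    by (intro prod_nonneg) (auto simp: euler_factor_def dest!: primes_le_ge_2)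
  ultimately have "5 / 4 * (\<Prod>p\<in>primes_le x - {q}. euler_factor p) \<le> euler_prod x"
    by (simp only: mult_right_mono)
  with 1 have "(\<Prod>p\<in>prime_factors N. euler_factor p) \<le> 4 / 5 * euler_prod x" by simp
  then show "real (sigma N) \<le> real N * (4 / 5 * euler_prod x)"
    using assms(3) by (intro order_trans[OF sigma_le_euler_factors] mult_left_mono) auto
  show "4 / 5 * euler_prod x < 71 / 40 * ln (theta x - 3219 / 2000)"
    using euler_prod_lt_finite_range[OF assms(2)] euler_prod_lt_large[of x] by linarith
  have fin: "finite (primes_le x - {q})" by simp
  have pr: "prime p" if "p \<in> primes_le x - {q}" for p using that by (auto simp: primes_le_def)
  have "ln (real q) \<le> ln 5" using assms(1) by (intro ln_mono) auto
  then have "theta x - 3219 / 2000 \<le> theta x - ln (real q)" using ln_bounds_small by simp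
  also have "\<dots> = (\<Sum>p\<in>primes_le x - {q}. ln (real p))"
    unfolding theta_def using q by (simp add: sum.remove)
  also have "\<dots> = ln (real (\<Prod>(primes_le x - {q})))"
    using fin pr by (rule ln_prod_primes[symmetric])
  also have "\<dots> \<le> ln (real N)"
  proof (intro ln_mono)
    have "0 < \<Prod>(primes_le x - {q})" using pr by (intro prod_pos) (auto simp: prime_gt_0_nat)
    then show "0 < real (\<Prod>(primes_le x - {q}))" by (simp only: of_nat_0_less_iff)
    have "\<Prod>(primes_le x - {q}) \<le> N" using 2 prod_prime_factors_le[of N] assms(3) by simp
    then show "real (\<Prod>(primes_le x - {q})) \<le> real N" by (simp only: of_nat_le_iff)
  qed
  finally show "ln (theta x - 3219 / 2000) \<le> ln (ln (real N))"
    using T by (intro ln_mono) auto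
  show "0 \<le> ln (theta x - 3219 / 2000)" using T by (intro ln_ge_zero) auto
  show "0 < N" using assms(3) by simp
qed

section \<open>Initial segments of primes below 19\<close>

lemma ln_ln_5041: "5040 < N \<Longrightarrow> 2142 / 1000 \<le> ln (ln (real N))"
  using ln_ln_ge[of 12 "12307 / 10000" 5041 N "10655 / 10000" 3] by simp

text \<open>The limit 3.8 lies just below 71/40 * 2.142.\<close>

lemma robin_small:
  assumes "5040 < N" "real (sigma N) \<le> real N * c" "c \<le> 38 / 10"
  shows "real (sigma N) < exp euler_mascheroni * real N * ln (ln (real N))"
  using assms by (intro robin_of_ln_ln_bound[OF assms(2) _ ln_ln_5041]) auto

lemma prod_euler_factors_mono:
  assumes "A \<subseteq> B" "finite B" "\<And>p. p \<in> B \<Longrightarrow> 2 \<le> p"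
  shows "(\<Prod>p\<in>A. euler_factor p) \<le> (\<Prod>p\<in>B. euler_factor p)"
  using assms by (intro prod_mono2) (auto intro: euler_factor_ge_1 order_trans[OF zero_le_one euler_factor_ge_1])

lemma robin_not_dvd_2_3:
  assumes "q \<in> {2, 3}" "5040 < N" "\<not> q dvd N"
  shows "real (sigma N) < exp euler_mascheroni * real N * ln (ln (real N))"
proof -
  obtain x where x: "(\<Prod>p\<in>prime_factors N. euler_factor p)
    \<le> (\<Prod>p\<in>primes_le x - {q}. euler_factor p)"
    "\<Prod>(primes_le x - {q}) \<le> \<Prod>(prime_factors N)"
    using sigma_bounds_initial_primes[of N q] assms by auto
  show ?thesis
  proof (cases "19 \<le> x")
    case True
    then show ?thesis using robin_large[of q x N] x assms by auto
  next
    case False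
    have "(\<Prod>p\<in>primes_le x - {q}. euler_factor p) \<le> (\<Prod>p\<in>primes_le 18 - {q}. euler_factor p)"
      using False primes_le_mono[of x 18]
      by (intro prod_euler_factors_mono) (auto dest: primes_le_ge_2)
    \<comment> \<open>Over all primes up to 17 the product is about 2.77 without 2 and about 3.69
      without 3.\<close>
    also have "\<dots> \<le> 38 / 10"
      using assms(1) by (auto simp: primes_le_18 euler_factor_def insert_Diff_if)
    finally have "(\<Prod>p\<in>prime_factors N. euler_factor p) \<le> 38 / 10" using x(1) by simp
    then show ?thesis
      using assms(2) sigma_le_euler_factors[of N] by (intro robin_small) auto
  qed
qed

text \<open>If 2 or 3 occurs to a low power, the saved factor brings \<open>c\<close> below the
  bound from \<open>B\<close>. Otherwise N is at least \<open>2 ^ a * 3 ^ b\<close> times the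
  product of its primes, and its double logarithm is large enough for \<open>c\<close>
  itself.\<close>

lemma robin_few_primes:
  fixes a b :: nat
  assumes N: "0 < N" and dvd: "2 dvd N" "3 dvd N"
    and c: "(\<Prod>p\<in>prime_factors N. euler_factor p) \<le> c"
    and B: "0 \<le> B" "B \<le> ln (ln (real N))"
    and small: "(1 - 1 / 2 ^ Suc a) * c < 71 / 40 * B" "(1 - 1 / 3 ^ Suc b) * c < 71 / 40 * B"
    and large: "2 ^ a * 3 ^ b * \<Prod>(prime_factors N) \<le> N \<Longrightarrow> c < 71 / 40 * ln (ln (real N))"
  shows "real (sigma N) < exp euler_mascheroni * real N * ln (ln (real N))"
proof -
  let ?F = "\<Prod>p\<in>prime_factors N. euler_factor p"
  have pf: "2 \<in> prime_factors N" "3 \<in> prime_factors N"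
    using dvd N by (auto simp: in_prime_factors_iff)
  have few: ?thesis if "real (sigma N) \<le> real N * ((1 - 1 / q ^ Suc e) * ?F)" "1 \<le> q"
    "(1 - 1 / q ^ Suc e) * c < 71 / 40 * B" for q :: real and e
  proof -
    have "1 \<le> q ^ Suc e" using that(2) by (rule one_le_power)
    then have "(1 - 1 / q ^ Suc e) * ?F \<le> (1 - 1 / q ^ Suc e) * c"
      using c by (intro mult_left_mono) (simp_all add: divide_le_eq del: power_Suc)
    then have "(1 - 1 / q ^ Suc e) * ?F < 71 / 40 * B" using that(3) by linarith
    then show ?thesis using that(1) B N by (intro robin_of_ln_ln_bound)
  qed
  consider "multiplicity 2 N < Suc a" | "multiplicity 3 N < Suc b"
    | "Suc a \<le> multiplicity 2 N" "Suc b \<le> multiplicity 3 N" by linarith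
  then show ?thesis
  proof cases
    case 1
    show ?thesis
      using few[of 2 a] sigma_le_small_multiplicity[OF N pf(1) 1] small by (simp del: power_Suc)
  next
    case 2
    show ?thesis
      using few[of 3 b] sigma_le_small_multiplicity[OF N pf(2) 2] small by (simp del: power_Suc)
  next
    case 3
    have "c < 71 / 40 * ln (ln (real N))"
      using large prod_prime_factors_mult_le[OF N pf 3] by simp
    then have "?F < 71 / 40 * ln (ln (real N))" using c by simp
    then show ?thesis
      using sigma_le_euler_factors[OF N] B N by (intro robin_of_ln_ln_bound[where B = "ln (ln (real N))"]) auto
  qed
qed

lemma primes_le_between:
  assumes "a \<le> x" "x \<le> b" "primes_le a = primes_le b"
  shows "primes_le x = primes_le b"
  using primes_le_mono[OF assms(1)] primes_le_mono[OF assms(2)] assms(3) by blast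

lemma primes_le_eqs: "primes_le 11 = primes_le 12" "primes_le 13 = primes_le 16" "primes_le 17 = primes_le 18"
  by (simp_all add: primes_le_eq_filter upt_rec_numeral)

lemma robin_not_dvd_5:
  assumes "5040 < N" "\<not> 5 dvd N"
  shows "real (sigma N) < exp euler_mascheroni * real N * ln (ln (real N))"
proof -
  have N: "0 < N" using assms(1) by simp
  obtain x where F: "(\<Prod>p\<in>prime_factors N. euler_factor p)
    \<le> (\<Prod>p\<in>primes_le x - {5}. euler_factor p)"
    and P: "\<Prod>(primes_le x - {5}) \<le> \<Prod>(prime_factors N)"
    using sigma_bounds_initial_primes[of N 5] assms by auto
  have le_N: "\<Prod>(primes_le x - {5}) \<le> N" using P prod_prime_factors_le[OF N] by simp
  consider "\<not> 2 dvd N" | "\<not> 3 dvd N" | "19 \<le> x" | "x \<le> 10" "2 dvd N" "3 dvd N"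
    | "11 \<le> x" "x \<le> 12" "2 dvd N" "3 dvd N" | "13 \<le> x" "x \<le> 16" "2 dvd N" "3 dvd N"
    | "17 \<le> x" "x \<le> 18" "2 dvd N" "3 dvd N"
    by linarith
  then show ?thesis
  proof cases
    case 1
    then show ?thesis using robin_not_dvd_2_3[of 2 N] assms by simp
  next
    case 2
    then show ?thesis using robin_not_dvd_2_3[of 3 N] assms by simp
  next
    case 3
    then show ?thesis using robin_large[of 5 x N] F P assms by simp
  next
    case 4
    have "(\<Prod>p\<in>primes_le x - {5}. euler_factor p) \<le> (\<Prod>p\<in>primes_le 10 - {5}. euler_factor p)"
      using 4 primes_le_mono[of x 10]
      by (intro prod_euler_factors_mono) (auto dest: primes_le_ge_2)
    also have "primes_le 10 - {5} = {2, 3, 7}"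
      by (simp add: primes_le_eq_filter upt_rec_numeral insert_Diff_if)
    also have "(\<Prod>p\<in>{2, 3, 7}. euler_factor p) \<le> 38 / 10"
      by (simp add: euler_factor_def)
    finally have "(\<Prod>p\<in>prime_factors N. euler_factor p) \<le> 38 / 10" using F by simp
    then show ?thesis
      using assms(1) sigma_le_euler_factors[of N] by (intro robin_small) auto
  next
    case 5
    then have "primes_le x = primes_le 12"
      by (intro primes_le_between[OF _ _ primes_le_eqs(1)])
    then have R: "primes_le x - {5} = {2, 3, 7, 11}"
      by (simp add: primes_le_eq_filter upt_rec_numeral insert_Diff_if)
    then have c: "(\<Prod>p\<in>prime_factors N. euler_factor p) \<le> 385 / 100"
      using F by (simp add: euler_factor_def)
    show ?thesis
    \<comment> \<open>The exponent 3 yields 24 * 462 = 11088; with 2 only 5544 would follow, too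
      small for 3.85.\<close>
    proof (rule robin_few_primes[OF N 5(3,4) c _ ln_ln_5041[OF assms(1)], of 3 1])
      assume "2 ^ 3 * 3 ^ 1 * \<Prod>(prime_factors N) \<le> N"
      then have "11088 \<le> N" using P R by simp
      then show "385 / 100 < 71 / 40 * ln (ln (real N))"
        using ln_ln_ge[of 13 "135 / 100" 11088 N "1163 / 1000" 3] by simp
    qed simp_all
  next
    case 6
    then have "primes_le x = primes_le 16"
      by (intro primes_le_between[OF _ _ primes_le_eqs(2)])
    then have R: "primes_le x - {5} = {2, 3, 7, 11, 13}"
      by (simp add: primes_le_eq_filter upt_rec_numeral insert_Diff_if)
    then have c: "(\<Prod>p\<in>prime_factors N. euler_factor p) \<le> 4171 / 1000"
      using F by (simp add: euler_factor_def)
    show ?thesis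
    proof (rule robin_few_primes[OF N 6(3,4) c _ ln_ln_5041[OF assms(1)], of 2 1])
      assume "2 ^ 2 * 3 ^ 1 * \<Prod>(prime_factors N) \<le> N"
      then have "72072 \<le> N" using P R by simp
      then show "4171 / 1000 < 71 / 40 * ln (ln (real N))"
        using ln_ln_ge[of 16 "1099 / 1000" 72072 N "1397 / 1000" 3] by simp
    qed simp_all
  next
    case 7
    then have "primes_le x = primes_le 18"
      by (intro primes_le_between[OF _ _ primes_le_eqs(3)])
    then have R: "primes_le x - {5} = {2, 3, 7, 11, 13, 17}"
      by (simp add: primes_le_18 insert_Diff_if)
    then have c: "(\<Prod>p\<in>prime_factors N. euler_factor p) \<le> 4432 / 1000"
      using F by (simp add: euler_factor_def)
    \<comment> \<open>The bound from \<open>ln_ln_5041\<close> is too weak here: 7/8 * 4.432 exceeds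
      71/40 * 2.142. The product 2 * 3 * 7 * 11 * 13 * 17 = 102102 gives a better one.\<close>
    have "102102 \<le> N" using le_N R by simp
    then have B: "24 / 10 \<le> ln (ln (real N))"
      using ln_ln_ge[of 16 "1557 / 1000" 102102 N "144 / 100" 3] by simp
    show ?thesis
    proof (rule robin_few_primes[OF N 7(3,4) c _ B, of 2 1])
      assume "2 ^ 2 * 3 ^ 1 * \<Prod>(prime_factors N) \<le> N"
      then have "1225224 \<le> N" using P R by simp
      then show "4432 / 1000 < 71 / 40 * ln (ln (real N))"
        using ln_ln_ge[of 20 "1168 / 1000" 1225224 N "1752 / 1000" 3] by simp
    qed simp_all
  qed
qed

theorem mainTheorem1:
  fixes j N :: nat
  assumes "j \<in> {1, 2, 3}"
    and "N > 5040"
    and "\<not> pth j dvd N"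
  shows "real (sigma N) < exp euler_mascheroni * real N * ln (ln (real N))"
proof -
  consider "j = 1" | "j = 2" | "j = 3" using assms(1) by auto
  then show ?thesis
    using assms(2,3) pth_eq robin_not_dvd_2_3[of 2 N] robin_not_dvd_2_3[of 3 N] robin_not_dvd_5[of N]
    by cases auto
qed

end
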